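(* For every Dyck path $\lambda$ of order $n$, $$\sum_{T\in\mathcal{D}(\lambda,* )} z^{\operatorname{dis}(T)}=\sum_{\sigma\in\mathscr{L}(P_\lambda)} z^{\operatorname{des}(\sigma)},$$ where $\operatorname{des}(\sigma)=\#\{i<n:\sigma_i>\sigma_{i+1}\}$.
   Context: A Dyck path of order $n$ is a lattice path from $(-n,0)$ to $(n,0)$ with steps $(+1,+1)$ (up) and $(+1,-1)$ (down) never going below the $x$-axis; its steps are numbered $1,\dots,2n$ from left to right. A box is a square with vertices $(x,y),(x+1,y+1),(x,y+2),(x-1,y+1)$, lying in column $x$. For Dyck paths $\lambda,\mu$ of order $n$ with $\mu$ weakly above $\lambda$, the skew shape $\lambda/\mu$ is the set of boxes between them. A Dyck tile is a nonempty set of boxes, one in each of a set of consecutive columns, whose lower corners read left to right form a lattice path with steps $(+1,\pm1)$ whose first and last points have equal height and no point lower than them. A Dyck tiling of $\lambda/\mu$ is a partition of its boxes into Dyck tiles. Tile $A$ covers tile $B$ if some box of $A$ lies directly above some box of $B$; the tiling is cover-inclusive if whenever $A$ covers $B$ the set of columns of $A$ is contained in that of $B$. $\mathcal{D}(\lambda,* )$ is the set of cover-inclusive Dyck tilings of $\lambda/\mu$ over all Dyck paths $\mu$ weakly above $\lambda$. For such $T$, $\operatorname{dis}(T)$ is the number of $k$ with step $k$ of $\lambda$ down and step $k$ of $\mu$ up. Each up step of $\lambda$ is matched with a down step as in balanced parentheses; such a pair is a chord. The chord poset $P_\lambda$: $c<c'$ iff both steps of $c'$ lie strictly between those of $c$.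 A natural labeling is a bijection $L:P_\lambda\to[n]$ with $L(c)<L(c')$ whenever $c<c'$; $L_0$ numbers chords by the left-to-right order of their up steps; $\mathscr{L}(P_\lambda)=\{L_0\circ L^{-1}:L\text{ natural}\}\subseteq S_n$. *)

theory Defs
  imports "HOL-Library.Disjoint_Sets" "HOL-Combinatorics.Permutations"
begin

section \<open>Dyck paths\<close>

datatype step = Up | Down

definition height :: "step list \<Rightarrow> nat \<Rightarrow> int" where
  "height p k = (\<Sum>s\<leftarrow>take k p. case s of Up \<Rightarrow> 1 | Down \<Rightarrow> - 1)"

definition dyck_path :: "nat \<Rightarrow> step list \<Rightarrow> bool" where
  "dyck_path n p \<longleftrightarrow>
     length p = 2 * n \<and> height p (2 * n) = 0 \<and> (\<forall>k\<le>2 * n. height p k \<ge> 0)"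

text \<open>Steps are numbered from 1, whereas list positions start at 0.\<close>

definition step_at :: "step list \<Rightarrow> nat \<Rightarrow> step" where
  "step_at p k = p ! (k - 1)"

text \<open>The path starts at \<open>(-n, 0)\<close>, so it passes the abscissa \<open>x\<close> after \<open>x + n\<close> steps;
  this is meaningful for \<open>-n \<le> x \<le> n\<close> only.\<close>

definition ordinate :: "nat \<Rightarrow> step list \<Rightarrow> int \<Rightarrow> int" where
  "ordinate n p x = height p (nat (x + int n))"

definition weakly_above :: "nat \<Rightarrow> step list \<Rightarrow> step list \<Rightarrow> bool" where
  "weakly_above n mu lam \<longleftrightarrow> (\<forall>k\<le>2 * n. height lam k \<le> height mu k)"


section \<open>Dyck tilings\<close>

text \<open>A box is represented by its lower corner; its column is the first coordinate.\<close>

type_synonym box = "int \<times> int"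

definition box_vertices :: "box \<Rightarrow> (int \<times> int) set" where
  "box_vertices b = (case b of (x, y) \<Rightarrow> {(x, y), (x + 1, y + 1), (x, y + 2), (x - 1, y + 1)})"

text \<open>The boxes lie on the lattice of the points that paths starting at \<open>(-n, 0)\<close> can visit,
  which is what the parity condition expresses. As the paths have slope \<open>\<plusminus>1\<close>, a box
  lies between them iff its vertices do.\<close>

definition skew_shape :: "nat \<Rightarrow> step list \<Rightarrow> step list \<Rightarrow> box set" where
  "skew_shape n lam mu =
     {(x, y). even (x + y + int n) \<and>
        (\<forall>(u, v)\<in>box_vertices (x, y).
           - int n \<le> u \<and> u \<le> int n \<and> ordinate n lam u \<le> v \<and> v \<le> ordinate n mu u)}"

definition dyck_tile :: "box set \<Rightarrow> bool" where
  "dyck_tile A \<longleftrightarrow>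
     (\<exists>a b f. a \<le> b \<and> A = {(x, f x) |x. a \<le> x \<and> x \<le> b} \<and>
        (\<forall>x. a \<le> x \<and> x < b \<longrightarrow> \<bar>f (x + 1) - f x\<bar> = 1) \<and>
        f a = f b \<and> (\<forall>x. a \<le> x \<and> x \<le> b \<longrightarrow> f a \<le> f x))"

definition dyck_tiling :: "nat \<Rightarrow> step list \<Rightarrow> step list \<Rightarrow> box set set \<Rightarrow> bool" where
  "dyck_tiling n lam mu T \<longleftrightarrow> partition_on (skew_shape n lam mu) T \<and> (\<forall>A\<in>T. dyck_tile A)"

definition columns :: "box set \<Rightarrow> int set" where
  "columns A = fst ` A"

text \<open>Other boxes may lie in between. Counting only vertically adjacent boxes would give
  the same cover-inclusive tilings, since columns of skew shapes have no gaps.\<close>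

definition covers :: "box set \<Rightarrow> box set \<Rightarrow> bool" where
  "covers A B \<longleftrightarrow> (\<exists>x y y'. (x, y') \<in> A \<and> (x, y) \<in> B \<and> y < y')"

definition cover_inclusive :: "box set set \<Rightarrow> bool" where
  "cover_inclusive T \<longleftrightarrow> (\<forall>A\<in>T. \<forall>B\<in>T. covers A B \<longrightarrow> columns A \<subseteq> columns B)"

text \<open>A tiling is paired with its upper path, which \<open>dis\<close> refers to. The upper
  path is determined by the lower path and the set of tiles, so no tiling is counted twice.\<close>

definition cover_inclusive_tilings :: "nat \<Rightarrow> step list \<Rightarrow> (step list \<times> box set set) set" where
  "cover_inclusive_tilings n lam =
     {(mu, T). dyck_path n mu \<and> weakly_above n mu lam \<and> dyck_tiling n lam mu T \<and> cover_inclusive T}"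

definition dis :: "nat \<Rightarrow> step list \<Rightarrow> step list \<Rightarrow> nat" where
  "dis n lam mu = card {k \<in> {1..2 * n}. step_at lam k = Down \<and> step_at mu k = Up}"


section \<open>The chord poset\<close>

text \<open>A chord is the pair of the numbers of its two steps: an up step \<open>i\<close> is matched with
  the first later step \<open>j\<close> that returns to the height before step \<open>i\<close>.\<close>

definition chords :: "nat \<Rightarrow> step list \<Rightarrow> (nat \<times> nat) set" where
  "chords n lam =
     {(i, j). 1 \<le> i \<and> i < j \<and> j \<le> 2 * n \<and> step_at lam i = Up \<and> step_at lam j = Down \<and>
        height lam j = height lam (i - 1) \<and>
        (\<forall>k. i \<le> k \<and> k < j \<longrightarrow> height lam (i - 1) < height lam k)}"

definition chord_less :: "nat \<times> nat \<Rightarrow> nat \<times> nat \<Rightarrow> bool" where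
  "chord_less c c' \<longleftrightarrow> fst c < fst c' \<and> snd c' < snd c"

definition natural_labeling :: "nat \<Rightarrow> step list \<Rightarrow> (nat \<times> nat \<Rightarrow> nat) \<Rightarrow> bool" where
  "natural_labeling n lam L \<longleftrightarrow>
     bij_betw L (chords n lam) {1..n} \<and>
     (\<forall>c\<in>chords n lam. \<forall>c'\<in>chords n lam. chord_less c c' \<longrightarrow> L c < L c')"

definition L0 :: "nat \<Rightarrow> step list \<Rightarrow> nat \<times> nat \<Rightarrow> nat" where
  "L0 n lam c = card {c' \<in> chords n lam. fst c' \<le> fst c}"

definition label_perms :: "nat \<Rightarrow> step list \<Rightarrow> (nat \<Rightarrow> nat) set" where
  "label_perms n lam =
     {\<sigma>. \<sigma> permutes {1..n} \<and>
        (\<exists>L. natural_labeling n lam L \<and>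
           (\<forall>i\<in>{1..n}. \<sigma> i = (L0 n lam \<circ> inv_into (chords n lam) L) i))}"

definition des :: "nat \<Rightarrow> (nat \<Rightarrow> nat) \<Rightarrow> nat" where
  "des n \<sigma> = card {i \<in> {1..<n}. \<sigma> i > \<sigma> (i + 1)}"


section \<open>Finiteness of the index sets\<close>

lemma finite_skew_shape: "finite (skew_shape n lam mu)"
proof (rule finite_subset)
  define H where "H = (\<lambda>p. (\<lambda>x. ordinate n p x) ` {- int n..int n})"
  show "skew_shape n lam mu \<subseteq> {- int n..int n} \<times> {Min (H lam)..Max (H mu)}"
  proof (rule subsetI)
    fix b assume b: "b \<in> skew_shape n lam mu"
    obtain x y where xy: "b = (x, y)" by force
    have 1: "- int n \<le> x" "x \<le> int n" "ordinate n lam x \<le> y" "y \<le> ordinate n mu x"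
      using b by (auto simp: xy skew_shape_def box_vertices_def)
    have "Min (H lam) \<le> ordinate n lam x" "ordinate n mu x \<le> Max (H mu)"
      using 1 by (auto simp: H_def)
    with 1 show "b \<in> {- int n..int n} \<times> {Min (H lam)..Max (H mu)}"
      by (auto simp: xy)
  qed
qed simp

lemma finite_cover_inclusive_tilings: "finite (cover_inclusive_tilings n lam)"
proof (rule finite_subset)
  have univ: "(UNIV :: step set) = {Up, Down}"
    using step.exhaust by blast
  have "finite {p :: step list. set p \<subseteq> UNIV \<and> length p = 2 * n}"
    by (rule finite_lists_length_eq) (simp add: univ)
  then show "finite (SIGMA p:{p :: step list. set p \<subseteq> UNIV \<and> length p = 2 * n}.
      Pow (Pow (skew_shape n lam p)))"
    by (intro finite_SigmaI) (auto simp: finite_skew_shape)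
  show "cover_inclusive_tilings n lam \<subseteq> (SIGMA p:{p. set p \<subseteq> UNIV \<and> length p = 2 * n}.
      Pow (Pow (skew_shape n lam p)))"
    by (auto simp: cover_inclusive_tilings_def dyck_path_def dyck_tiling_def partition_on_def)
qed

lemma finite_label_perms: "finite (label_perms n lam)"
  by (rule finite_subset[OF _ finite_permutations[of "{1..n}"]]) (auto simp: label_perms_def)

end

theory Submission
  imports Defs "HOL-Computational_Algebra.Formal_Power_Series"
begin

text \<open>
  By cover-inclusiveness, every tile of a cover-inclusive tiling is a vertical translate of a Dyck
  subpath of the lower path. Hence a tiling amounts to an upper path together with a number for
  each step of the lower path (how many tiles cross it); these numbers are constant on chords,
  weakly increase towards inner chords and are bounded by the heights of the skew shape at the two
  ends of the step.

  These data are counted by transfer operators on power series in \<open>x\<close> over \<open>\<int>[[z]]\<close>. The operators of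
  all Dyck words have the common eigenvectors \<open>f\<^sub>k = (x + z)^k / (1 + x)^(k + 1)\<close>, with eigenvalues
  \<open>(1 - z)^n \<Omega>(k)\<close>, where \<open>\<Omega>(k)\<close> is the number of order-preserving maps from the chord poset to
  \<open>{0..k}\<close>. Since \<open>1 = (1 - z) (f\<^sub>0 + f\<^sub>1 + \<dots>)\<close> and \<open>f\<^sub>k\<close> has constant term \<open>z^k\<close>, the tilings have the
  generating function \<open>(1 - z)^(n + 1) (\<Omega>(0) + \<Omega>(1) z + \<Omega>(2) z^2 + \<dots>)\<close>. By Stanley's theory of
  \<open>P\<close>-partitions, this is also the descent generating function of the linear extensions.
\<close>

unbundle fps_syntax

section \<open>Transfer operators and their eigenvectors\<close>

text \<open>For a single chord the operator is f -> (1 + x) d/dx ((x + z) f): the sum over crossing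
  numbers multiplies the coefficient of x^p by p + 1, and the constant in which x times
  \<open>downstep f\<close> differs from (x + z) f is killed by differentiation. Separation of
  variables in (1 + x) ((x + z) f)' = \<lambda> f gives \<lambda> = (1 - z) (k + 1) and the series
  f_k; this is where they come from. That longer words share them is not automatic, because a chord
  shifts the vectors seen inside it, and shifts do not in general preserve the lines spanned by the
  f_k. The way out is to eliminate the shift in favour of \<open>downstep\<close>, which is
  triangular on the f_k.

  The series 1 and the constant coefficient express the boundary conditions of a skew shape: no
  boxes above the last and none above the first vertex.\<close>

datatype dtree = Leaf | Node dtree dtree

text \<open>If the root chord has value i, the chords of \<open>u\<close> take values in {i..k}; the
  summation index is j = k - i.\<close>

fun omega :: "dtree \<Rightarrow> nat \<Rightarrow> nat" where
  "omega Leaf k = 1"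
| "omega (Node u v) k = (\<Sum>j\<le>k. omega u j) * omega v k"

abbreviation zz :: "int fps fps" where "zz \<equiv> fps_const fps_X"

text \<open>A power series stands for a column vector indexed by the number of boxes above a vertex. In
  \<open>layered\<close>, \<open>c\<close> is the number of tiles crossing a chord; these lie below everything that happens
  inside the chord, so \<open>c\<close> is subtracted from all heights there. The factor \<open>1 + x\<close> comes from the
  up step of the chord.\<close>

definition layered :: "(int fps fps \<Rightarrow> int fps fps) \<Rightarrow> int fps fps \<Rightarrow> int fps fps" where
  "layered G g = Abs_fps (\<lambda>p. \<Sum>c\<le>p. G (fps_shift c g) $ (p - c))"

text \<open>Along a down step of the lower path, the upper path either goes down too and keeps the
  number of boxes, or goes up, which adds a box and contributes a factor z.\<close>

definition downstep :: "int fps fps \<Rightarrow> int fps fps" where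
  "downstep g = g + zz * fps_shift 1 g"

fun transfer :: "dtree \<Rightarrow> int fps fps \<Rightarrow> int fps fps" where
  "transfer Leaf f = f"
| "transfer (Node u v) f = (1 + fps_X) * layered (transfer u) (downstep (transfer v f))"

lemma downstep_add: "downstep (f + g) = downstep f + downstep g"
  by (simp add: downstep_def fps_shift_add algebra_simps)

lemma fps_shift_const_mult: "fps_shift k (fps_const (a :: int fps) * f) = fps_const a * fps_shift k f"
  by (simp add: fps_eq_iff)

lemma downstep_scale: "downstep (fps_const a * f) = fps_const a * downstep f"
  unfolding downstep_def fps_shift_const_mult by (simp add: algebra_simps)

lemma transfer_add: "transfer w (f + g) = transfer w f + transfer w g"
proof (induction w arbitrary: f g)
  case (Node u v)
  have "layered (transfer u) (a + b) = layered (transfer u) a + layered (transfer u) b" for a b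
    by (simp add: layered_def fps_eq_iff fps_shift_add Node.IH(1) sum.distrib)
  then show ?case by (simp add: Node.IH(2) downstep_add algebra_simps)
qed simp

lemma transfer_scale: "transfer w (fps_const a * f) = fps_const a * transfer w f"
proof (induction w arbitrary: f)
  case (Node u v)
  have "layered (transfer u) (fps_const a * g) = fps_const a * layered (transfer u) g" for g
    by (simp add: layered_def fps_eq_iff fps_shift_const_mult Node.IH(1) sum_distrib_left)
  then show ?case by (simp only: transfer.simps Node.IH(2) downstep_scale mult.left_commute)
qed simp

lemma transfer_zero: "transfer w 0 = 0"
  using transfer_scale[of w 0 0] by simp

lemma transfer_sum: "transfer w (sum f A) = (\<Sum>x\<in>A. transfer w (f x))"
  by (induction A rule: infinite_finite_induct) (simp_all add: transfer_zero transfer_add)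

lemma layered_add: "layered (transfer u) (a + b) = layered (transfer u) a + layered (transfer u) b"
  by (simp add: layered_def fps_eq_iff fps_shift_add transfer_add sum.distrib)

lemma layered_scale: "layered (transfer u) (fps_const a * g) = fps_const a * layered (transfer u) g"
  by (simp add: layered_def fps_eq_iff fps_shift_const_mult transfer_scale sum_distrib_left)

text \<open>Splits off c = 0. In the remaining terms c drops by one, which costs one shift of the
  argument and one factor x.\<close>

lemma layered_rec: "layered G g = G g + fps_X * layered G (fps_shift 1 g)"
proof (rule fps_ext)
  fix p show "layered G g $ p = (G g + fps_X * layered G (fps_shift 1 g)) $ p"
  proof (cases p)
    case (Suc p')
    have "(\<Sum>c\<le>Suc p'. G (fps_shift c g) $ (Suc p' - c)) =
      G g $ Suc p' + (\<Sum>c\<le>p'. G (fps_shift 1 (fps_shift c g)) $ (p' - c))"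
      by (subst sum.atMost_Suc_shift) (simp flip: fps_shift_fps_shift)
    then show ?thesis using Suc
      by (simp add: layered_def flip: fps_shift_fps_shift)
  qed (simp add: layered_def)
qed

text \<open>The series \<open>1 / (1 + x)\<close>; division of power series is only available over fields.\<close>

definition alt :: "int fps fps" where "alt = Abs_fps (\<lambda>n. (-1) ^ n)"

lemma alt_inverse: "(1 + fps_X) * alt = 1"
proof (rule fps_ext)
  fix n show "((1 + fps_X) * alt) $ n = 1 $ n"
    by (cases n) (simp_all add: alt_def algebra_simps)
qed

section \<open>The common eigenvectors and their eigenvalues\<close>

definition mob :: "int fps fps" where "mob = (fps_X + zz) * alt"

definition eigf :: "nat \<Rightarrow> int fps fps" where "eigf k = mob ^ k * alt"

lemma eigf_Suc: "(1 + fps_X) * eigf (Suc k) = (fps_X + zz) * eigf k"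
proof -
  have "(1 + fps_X) * eigf (Suc k) = ((1 + fps_X) * alt) * ((fps_X + zz) * eigf k)"
    by (simp add: eigf_def mob_def algebra_simps)
  then show ?thesis by (simp add: alt_inverse)
qed

lemma mob_nth_0: "mob $ 0 = fps_X"
  by (simp add: mob_def alt_def)

lemma eigf_nth_0: "eigf k $ 0 = fps_X ^ k"
  by (simp add: eigf_def mob_nth_0 fps_power_zeroth alt_def)

lemma X_times_shift: "fps_X * fps_shift 1 (f :: int fps fps) = f - fps_const (f $ 0)"
proof (rule fps_ext)
  fix n show "(fps_X * fps_shift 1 f) $ n = (f - fps_const (f $ 0)) $ n"
    by (cases n) simp_all
qed

text \<open>Multiplying by x removes the shift at the price of a constant term. Identities for
  \<open>downstep\<close> thus become algebraic identities between series, and x is cancelled at the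
  end.\<close>

lemma X_times_downstep: "fps_X * downstep f = (fps_X + zz) * f - fps_const (fps_X * f $ 0)"
proof -
  have "fps_X * downstep f = fps_X * f + zz * (fps_X * fps_shift 1 f)"
    by (simp add: downstep_def algebra_simps)
  then show ?thesis unfolding X_times_shift by (simp add: algebra_simps)
qed

text \<open>\<open>eigf 0\<close> is the geometric series in -x, so the shift acts on it as
  multiplication by -1.\<close>

lemma downstep_eigf_0: "downstep (eigf 0) = (1 - zz) * eigf 0"
proof -
  have "(fps_X * (1 + fps_X)) * downstep (eigf 0) =
      (1 + fps_X) * ((fps_X + zz) * eigf 0) - (1 + fps_X) * zz"
    using X_times_downstep[of "eigf 0"] unfolding eigf_nth_0
    by (simp only: mult.assoc mult.left_commute[of fps_X "1 + fps_X"] right_diff_distrib) simp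
  also have "\<dots> = (fps_X + zz) * ((1 + fps_X) * alt) - (1 + fps_X) * zz"
    by (simp add: eigf_def algebra_simps)
  also have "\<dots> = fps_X * (1 - zz)" by (simp only: alt_inverse) (simp add: algebra_simps)
  also have "\<dots> = fps_X * (1 - zz) * ((1 + fps_X) * alt)" by (simp only: alt_inverse mult_1_right)
  also have "\<dots> = (fps_X * (1 + fps_X)) * ((1 - zz) * eigf 0)" 
    by (simp add: eigf_def)
  finally have *: "(fps_X * (1 + fps_X)) * downstep (eigf 0) = (fps_X * (1 + fps_X)) * ((1 - zz) * eigf 0)" .
  have "(1 + fps_X :: int fps fps) \<noteq> 0" using alt_inverse by auto
  then show ?thesis using * by simp
qed

text \<open>Unfolded: \<open>downstep (eigf k)\<close> is 1 - z times the sum of z^(k - j)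
  \<open>eigf j\<close> over j \<le> k. The operator is triangular on these vectors, not
  diagonal.\<close>

lemma downstep_eigf_Suc:
  "downstep (eigf (Suc k)) = zz * downstep (eigf k) + (1 - zz) * eigf (Suc k)"
proof -
  have c: "fps_const (fps_X * fps_X ^ k) = zz * zz ^ k" for k
    by (simp only: fps_const_power fps_const_mult)
  have "fps_X * downstep (eigf (Suc k)) = (fps_X + zz) * eigf (Suc k) - zz * (zz * zz ^ k)"
    using X_times_downstep[of "eigf (Suc k)"] unfolding eigf_nth_0 c
    unfolding power_Suc .
  also have "(fps_X + zz) * eigf (Suc k) = zz * ((1 + fps_X) * eigf (Suc k)) + fps_X * ((1 - zz) * eigf (Suc k))"
    by (simp add: algebra_simps)
  also have "\<dots> = zz * ((fps_X + zz) * eigf k) + fps_X * ((1 - zz) * eigf (Suc k))"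
    by (simp only: eigf_Suc)
  also have "\<dots> - zz * (zz * zz ^ k) = zz * ((fps_X + zz) * eigf k - zz * zz ^ k) + fps_X * ((1 - zz) * eigf (Suc k))"
    by (simp add: algebra_simps)
  also have "(fps_X + zz) * eigf k - zz * zz ^ k = fps_X * downstep (eigf k)"
    using X_times_downstep[of "eigf k"] unfolding eigf_nth_0 c by (rule sym)
  also have "zz * (fps_X * downstep (eigf k)) + fps_X * ((1 - zz) * eigf (Suc k))
     = fps_X * (zz * downstep (eigf k) + (1 - zz) * eigf (Suc k))"
    by (simp add: algebra_simps)
  finally show ?thesis by simp
qed

text \<open>The off-diagonal terms of \<open>downstep\<close> and of \<open>layered\<close>
  compensate each other once the factor 1 + x of the up step is included. What accumulates along the
  triangular expansion is the sum of the eigenvalues up to k, in agreement with the recursion of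
  \<open>omega\<close> at a root.\<close>

lemma layered_eigf:
  assumes "\<And>k. transfer u (eigf k) = fps_const (ev k) * eigf k"
  shows "(1 + fps_X) * layered (transfer u) (downstep (eigf k)) =
         fps_const ((1 - fps_X) * (\<Sum>j\<le>k. ev j)) * eigf k"
proof -
  define h where "h k = layered (transfer u) (downstep (eigf k))" for k
  have one: "1 - zz = fps_const (1 - fps_X)" by (simp add: fps_const_sub[symmetric] del: fps_const_sub)
  have ne: "(1 + fps_X :: int fps fps) \<noteq> 0" using alt_inverse by auto
  \<comment> \<open>The unwanted term of \<open>layered_rec\<close> is the one with the shifted
    series. By the definition of \<open>downstep\<close>, z times it equals \<open>h k\<close> minus
    \<open>layered (transfer u) (eigf k)\<close>; this is the origin of the factor z + x.\<close>
  have key: "(zz + fps_X) * layered (transfer u) (eigf k) = zz * (fps_const (ev k) * eigf k) + fps_X * h k" for k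
  proof -
    have "zz * layered (transfer u) (eigf k) =
       zz * (fps_const (ev k) * eigf k) + fps_X * (zz * layered (transfer u) (fps_shift 1 (eigf k)))"
      using layered_rec[of "transfer u" "eigf k"] assms[of k] by (simp add: algebra_simps)
    also have "zz * layered (transfer u) (fps_shift 1 (eigf k)) = h k - layered (transfer u) (eigf k)"
      using layered_add[of u "eigf k" "zz * fps_shift 1 (eigf k)"]
      by (simp add: h_def downstep_def layered_scale)
    finally show ?thesis by (simp add: algebra_simps)
  qed
  show ?thesis unfolding h_def[symmetric]
  proof (induction k)
    case 0
    have h0: "h 0 = (1 - zz) * layered (transfer u) (eigf 0)"
      unfolding h_def downstep_eigf_0 one layered_scale ..
    have "(zz + fps_X) * h 0 = (1 - zz) * ((zz + fps_X) * layered (transfer u) (eigf 0))"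
      by (simp add: h0 algebra_simps)
    also have "\<dots> = (1 - zz) * (zz * (fps_const (ev 0) * eigf 0) + fps_X * h 0)"
      by (simp only: key)
    \<comment> \<open>The terms with \<open>h 0\<close> collect to (z + x) - (1 - z) x = z (1 + x),
      so that z can be cancelled. The same happens in the induction step.\<close>
    finally have "zz * ((1 + fps_X) * h 0) = zz * ((1 - zz) * fps_const (ev 0) * eigf 0)"
      by (simp add: algebra_simps)
    then show ?case by (simp add: one)
  next
    case (Suc k)
    have hS: "h (Suc k) = zz * h k + (1 - zz) * layered (transfer u) (eigf (Suc k))"
      unfolding h_def downstep_eigf_Suc one layered_add layered_scale ..
    have "(zz + fps_X) * h (Suc k) = (zz + fps_X) * zz * h k
        + (1 - zz) * ((zz + fps_X) * layered (transfer u) (eigf (Suc k)))"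
      by (simp add: hS algebra_simps)
    also have "\<dots> = (zz + fps_X) * zz * h k
        + (1 - zz) * (zz * (fps_const (ev (Suc k)) * eigf (Suc k)) + fps_X * h (Suc k))"
      by (simp only: key)
    finally have "zz * ((1 + fps_X) * h (Suc k)) =
        zz * ((zz + fps_X) * h k + (1 - zz) * fps_const (ev (Suc k)) * eigf (Suc k))"
      by (simp add: algebra_simps)
    then have "(1 + fps_X) * h (Suc k) =
        (zz + fps_X) * h k + (1 - zz) * fps_const (ev (Suc k)) * eigf (Suc k)"
      by simp
    \<comment> \<open>The additional factor 1 + x brings the first summand into the form of the
      induction hypothesis; \<open>eigf_Suc\<close> then trades (x + z) \<open>eigf k\<close> for (1
      + x) \<open>eigf (Suc k)\<close>.\<close>
    then have "(1 + fps_X) * ((1 + fps_X) * h (Suc k)) =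
        (zz + fps_X) * ((1 + fps_X) * h k) + (1 + fps_X) * ((1 - zz) * fps_const (ev (Suc k)) * eigf (Suc k))"
      by (simp add: algebra_simps)
    also have "\<dots> = fps_const ((1 - fps_X) * (\<Sum>j\<le>k. ev j)) * ((fps_X + zz) * eigf k)
        + (1 + fps_X) * ((1 - zz) * fps_const (ev (Suc k)) * eigf (Suc k))"
      unfolding Suc.IH by (simp only: ac_simps)
    also have "\<dots> = (1 + fps_X) * (fps_const ((1 - fps_X) * (\<Sum>j\<le>Suc k. ev j)) * eigf (Suc k))"
      unfolding eigf_Suc[symmetric] one
      by (simp add: distrib_left distrib_right fps_const_add[symmetric] fps_const_mult[symmetric]
           mult.assoc mult.left_commute del: fps_const_add fps_const_mult)
    finally show ?case using ne by simp
  qed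
qed

lemma transfer_eigf:
  "transfer w (eigf k) = fps_const ((1 - fps_X) ^ size w * of_nat (omega w k)) * eigf k"
proof (induction w arbitrary: k)
  case (Node u v)
  let ?a = "(1 - fps_X) ^ size v * of_nat (omega v k) :: int fps"
  let ?b = "(1 - fps_X) ^ size u :: int fps"
  have "layered (transfer u) (downstep (transfer v (eigf k))) =
      fps_const ?a * layered (transfer u) (downstep (eigf k))"
    by (simp only: Node.IH(2) downstep_scale layered_scale)
  then have "transfer (Node u v) (eigf k) =
      fps_const ?a * ((1 + fps_X) * layered (transfer u) (downstep (eigf k)))"
    by (simp only: transfer.simps mult.left_commute[of "1 + fps_X" "fps_const ?a"])
  also have "\<dots> = fps_const (?a * ((1 - fps_X) * (\<Sum>j\<le>k. ?b * of_nat (omega u j)))) * eigf k"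
    by (subst layered_eigf[OF Node.IH(1)]) (simp only: mult.assoc[symmetric] fps_const_mult)
  also have "(\<Sum>j\<le>k. ?b * of_nat (omega u j)) = ?b * of_nat (\<Sum>j\<le>k. omega u j)"
    by (simp only: sum_distrib_left[symmetric] of_nat_sum)
  also have "?a * ((1 - fps_X) * (?b * of_nat (\<Sum>j\<le>k. omega u j)))
     = (1 - fps_X) ^ size (Node u v) * of_nat (omega (Node u v) k)"
    by (simp add: power_add mult_ac)
  finally show ?case .
qed simp

section \<open>Expansion of 1 into eigenvectors and the (x, z)-adic filtration\<close>

lemma sum_eigf: "(1 - zz) * (\<Sum>k<K. eigf k) = 1 - mob ^ K"
proof -
  have "(1 - zz) * alt = (1 + fps_X) * alt - mob" by (simp add: mob_def algebra_simps)
  then have m: "(1 - zz) * alt = 1 - mob" by (simp only: alt_inverse)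
  have "(1 - zz) * (\<Sum>k<K. eigf k) = ((1 - zz) * alt) * (\<Sum>k<K. mob ^ k)"
    by (simp add: eigf_def sum_distrib_left ac_simps)
  then show ?thesis unfolding m by (simp only: one_diff_power_eq)
qed

text \<open>This filtration replaces convergence: it makes \<open>mob ^ K\<close>, the remainder in the expansion of \<open>1\<close>
  into eigenvectors, negligible modulo \<open>z^K\<close>.\<close>

definition adic :: "nat \<Rightarrow> int fps fps \<Rightarrow> bool" where
  "adic M F \<longleftrightarrow> (\<forall>q. fps_X ^ (M - q) dvd F $ q)"

lemma adic_power_dvd: "adic M F \<Longrightarrow> a \<le> M - q \<Longrightarrow> fps_X ^ a dvd F $ q"
  unfolding adic_def by (meson dvd_trans le_imp_power_dvd)

lemma adic_mult:
  assumes "adic M F" "adic K G" shows "adic (M + K) (F * G)"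
  unfolding adic_def
proof
  fix q
  have "fps_X ^ (M + K - q) dvd F $ i * G $ (q - i)" if "i \<le> q" for i
  proof -
    have "fps_X ^ ((M - i) + (K - (q - i))) dvd F $ i * G $ (q - i)"
      unfolding power_add using assms by (auto simp: adic_def intro: mult_dvd_mono)
    moreover have "M + K - q \<le> (M - i) + (K - (q - i))" using that by simp
    ultimately show ?thesis by (meson dvd_trans le_imp_power_dvd)
  qed
  then show "fps_X ^ (M + K - q) dvd (F * G) $ q"
    by (auto simp: fps_mult_nth intro: dvd_sum)
qed

lemma adic_0: "adic 0 F"
  by (simp add: adic_def)

lemma adic_mob: "adic K (mob ^ K)"
proof (induction K)
  case (Suc K)
  have "adic 1 (fps_X + zz)"
    by (auto simp: adic_def fps_X_def)
  from adic_mult[OF this adic_0] have "adic 1 mob" by (simp add: mob_def)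
  from adic_mult[OF this Suc] show ?case by simp
qed (simp add: adic_0)

text \<open>A shift by one lowers the filtration by one. In \<open>downstep\<close> the factor z
  makes up for it; in \<open>layered\<close> a shift by c is paired with the coefficient p - c, and
  (M - c) - (p - c) = M - p.\<close>

lemma adic_transfer: "adic M F \<Longrightarrow> adic M (transfer w F)"
proof (induction w arbitrary: M F)
  case (Node u v)
  define g where "g = downstep (transfer v F)"
  have v: "adic M (transfer v F)" using Node by blast
  have g: "adic M g" unfolding adic_def
  proof
    fix q
    have "fps_X ^ (M - q) dvd fps_X * transfer v F $ Suc q"
    proof (cases "M - q")
      case (Suc a)
      then have "fps_X ^ a dvd transfer v F $ Suc q" by (intro adic_power_dvd[OF v]) simp
      then show ?thesis using Suc by (simp add: mult_dvd_mono)
    qed simp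
    then show "fps_X ^ (M - q) dvd g $ q"
      using adic_power_dvd[OF v order_refl, of q] by (simp add: g_def downstep_def)
  qed
  have "adic M (layered (transfer u) g)" unfolding adic_def
  proof
    fix p
    have "fps_X ^ (M - p) dvd transfer u (fps_shift c g) $ (p - c)" if "c \<le> p" for c
    proof -
      have "adic (M - c) (fps_shift c g)"
        unfolding adic_def using adic_power_dvd[OF g] by simp
      from Node.IH(1)[OF this] show ?thesis
        by (rule adic_power_dvd) (use that in simp)
    qed
    then show "fps_X ^ (M - p) dvd layered (transfer u) g $ p"
      by (auto simp: layered_def intro: dvd_sum)
  qed
  from adic_mult[OF adic_0 this, of "1 + fps_X"] show ?case by (simp add: g_def)
qed simp

lemma transfer_one:
  "transfer w 1 $ 0 = (1 - fps_X) ^ Suc (size w) * Abs_fps (\<lambda>k. of_nat (omega w k))"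
proof (rule fps_ext)
  fix d
  \<comment> \<open>The identity is established modulo z^K, and K > d suffices to compare the
    coefficients of z^d.\<close>
  define K where "K = Suc d"
  define S where "S = (\<Sum>k<K. of_nat (omega w k) * fps_X ^ k :: int fps)"
  let ?A = "Abs_fps (\<lambda>k. of_nat (omega w k)) :: int fps"
  have one: "1 - zz = fps_const (1 - fps_X)" by (simp add: fps_const_sub[symmetric] del: fps_const_sub)
  have "1 = fps_const (1 - fps_X) * (\<Sum>k<K. eigf k) + mob ^ K"
    using sum_eigf[of K] by (simp add: one)
  then have "transfer w 1 = fps_const (1 - fps_X) * (\<Sum>k<K. transfer w (eigf k)) + transfer w (mob ^ K)"
    by (metis transfer_add transfer_scale transfer_sum)
  then have "transfer w 1 $ 0 = (1 - fps_X) ^ Suc (size w) * S + transfer w (mob ^ K) $ 0"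
    by (simp add: transfer_eigf fps_sum_nth eigf_nth_0 S_def sum_distrib_left mult.assoc)
  moreover have "fps_X ^ K dvd transfer w (mob ^ K) $ 0"
    by (rule adic_power_dvd[OF adic_transfer[OF adic_mob]]) simp
  moreover have "fps_X ^ K dvd (1 - fps_X) ^ Suc (size w) * ?A - (1 - fps_X) ^ Suc (size w) * S"
  proof -
    have "?A - S = fps_X ^ K * fps_shift K ?A"
    proof (rule fps_ext)
      fix j 
      have "S $ j = (\<Sum>k<K. if j = k then of_nat (omega w k) else 0)"
        unfolding S_def fps_sum_nth
        by (rule sum.cong) (auto simp: fps_of_nat[symmetric])
      then show "(?A - S) $ j = (fps_X ^ K * fps_shift K ?A) $ j"
        by (auto simp: fps_X_power_mult_nth)
    qed
    then show ?thesis by (simp add: right_diff_distrib[symmetric])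
  qed
  ultimately have "fps_X ^ K dvd transfer w (mob ^ K) $ 0 -
      ((1 - fps_X) ^ Suc (size w) * ?A - (1 - fps_X) ^ Suc (size w) * S)"
    by (blast intro: dvd_diff)
  also have "\<dots> = transfer w 1 $ 0 - (1 - fps_X) ^ Suc (size w) * ?A"
    using \<open>transfer w 1 $ 0 = _\<close> by simp
  finally have "fps_X ^ K dvd transfer w 1 $ 0 - (1 - fps_X) ^ Suc (size w) * ?A" .
  then obtain r where "transfer w 1 $ 0 - (1 - fps_X) ^ Suc (size w) * ?A = fps_X ^ K * r" by (elim dvdE)
  then have "(transfer w 1 $ 0 - (1 - fps_X) ^ Suc (size w) * ?A) $ d = (fps_X ^ K * r) $ d" by simp
  also have "\<dots> = 0" by (simp only: fps_X_power_mult_nth K_def) simp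
  finally show "transfer w 1 $ 0 $ d = ((1 - fps_X) ^ Suc (size w) * ?A) $ d" by simp
qed

section \<open>Order-preserving maps and descents\<close>

text \<open>Two increasing enumerations of the same set of values agree, and injectivity of g
  carries this over to the permutations. Uniqueness is what later makes the classes of
  order-preserving maps disjoint.\<close>

lemma sorting_permutation_ex1:
  fixes g :: "nat \<Rightarrow> nat"
  assumes inj: "inj_on g {1..n}"
  shows "\<exists>!\<sigma>. \<sigma> permutes {1..n} \<and> strict_mono_on {1..n} (g \<circ> \<sigma>)"
proof (rule ex_ex1I)
  define xs where "xs = sorted_list_of_set (g ` {1..n})"
  have len: "length xs = n" using inj by (simp add: xs_def card_image)
  have set: "set xs = g ` {1..n}" by (simp add: xs_def)
  have dist: "distinct xs" by (simp add: xs_def)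
  have srt: "sorted_wrt (<) xs" by (simp add: xs_def)
  define \<sigma> where "\<sigma> i = (if i \<in> {1..n} then inv_into {1..n} g (xs ! (i - 1)) else i)" for i
  have mem: "xs ! (i - 1) \<in> g ` {1..n}" if "i \<in> {1..n}" for i
    using that len set nth_mem[of "i - 1" xs] by auto
  have g\<sigma>: "g (\<sigma> i) = xs ! (i - 1)" if "i \<in> {1..n}" for i
    using f_inv_into_f[OF mem[OF that]] that by (simp add: \<sigma>_def)
  have mono: "strict_mono_on {1..n} (g \<circ> \<sigma>)"
  proof (rule strict_mono_onI)
    fix r s assume rs: "r \<in> {1..n}" "s \<in> {1..n}" "r < s"
    then have "r - 1 < s - 1" "s - 1 < length xs" using len by auto
    then have "xs ! (r - 1) < xs ! (s - 1)" using srt by (rule_tac sorted_wrt_nth_less)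
    then show "(g \<circ> \<sigma>) r < (g \<circ> \<sigma>) s" using rs by (simp add: g\<sigma>)
  qed
  have "inj_on \<sigma> {1..n}"
    using strict_mono_on_imp_inj_on[OF mono] by (rule inj_on_imageI2)
  moreover have "\<sigma> ` {1..n} \<subseteq> {1..n}"
    using inv_into_into[OF mem] by (auto simp: \<sigma>_def)
  ultimately have "bij_betw \<sigma> {1..n} {1..n}"
    by (simp add: bij_betw_def endo_inj_surj)
  then have "\<sigma> permutes {1..n}"
    by (rule bij_imp_permutes) (auto simp: \<sigma>_def)
  with mono show "\<exists>\<sigma>. \<sigma> permutes {1..n} \<and> strict_mono_on {1..n} (g \<circ> \<sigma>)" by blast
next
  fix \<sigma> \<tau>
  assume a: "\<sigma> permutes {1..n} \<and> strict_mono_on {1..n} (g \<circ> \<sigma>)"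
    "\<tau> permutes {1..n} \<and> strict_mono_on {1..n} (g \<circ> \<tau>)"
  define L where "L \<rho> = map (g \<circ> \<rho>) [1..<Suc n]" for \<rho>
  have L: "sorted (L \<rho>) \<and> distinct (L \<rho>) \<and> set (L \<rho>) = g ` {1..n}"
    if "\<rho> permutes {1..n}" "strict_mono_on {1..n} (g \<circ> \<rho>)" for \<rho>
  proof -
    have "sorted_wrt (<) (L \<rho>)"
      using strict_mono_onD[OF that(2)]
      by (auto simp: L_def sorted_wrt_iff_nth_less nth_append simp del: upt_Suc)
    then have "sorted (L \<rho>)" "distinct (L \<rho>)" by (simp_all add: strict_sorted_iff)
    moreover have "set (L \<rho>) = g ` (\<rho> ` {1..n})"
      by (auto simp: L_def image_image simp del: upt_Suc)
    ultimately show ?thesis using permutes_image[OF that(1)] by simp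
  qed
  have "L \<sigma> = L \<tau>" using L a by (metis sorted_distinct_set_unique)
  then have eq: "g (\<sigma> i) = g (\<tau> i)" if "i \<in> {1..n}" for i
    using that by (auto simp: L_def simp del: upt_Suc)
  show "\<sigma> = \<tau>"
  proof
    fix i show "\<sigma> i = \<tau> i"
    proof (cases "i \<in> {1..n}")
      case True
      then show ?thesis using inj_onD[OF inj eq[OF True]] a permutes_in_image by metis
    next
      case False
      then show ?thesis using a permutes_not_in by metis
    qed
  qed
qed

section \<open>Monotone sequences that are strict at the descents of a permutation\<close>

definition dchains :: "(nat \<Rightarrow> nat) \<Rightarrow> nat \<Rightarrow> nat \<Rightarrow> (nat \<Rightarrow> nat) set" where
  "dchains \<sigma> j k = {a \<in> {1..j} \<rightarrow>\<^sub>E {..k}.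
     \<forall>i\<in>{1..<j}. a i \<le> a (Suc i) \<and> (\<sigma> i > \<sigma> (Suc i) \<longrightarrow> a i < a (Suc i))}"

lemma finite_dchains: "finite (dchains \<sigma> j k)"
  unfolding dchains_def by (rule finite_subset[OF _ finite_PiE[of "{1..j}" "\<lambda>_. {..k}"]]) auto

text \<open>A tie between neighbours rules out a descent, and injectivity rules out equality, so
  \<sigma> increases along a run of equal entries. In other words, \<sigma> lists its values in the
  lexicographic order of (entry, label).\<close>

lemma dchains_mono:
  assumes "a \<in> dchains \<sigma> j k" "inj_on \<sigma> {1..j}" "i < i'" "1 \<le> i" "i' \<le> j"
  shows "a i < a i' \<or> a i = a i' \<and> \<sigma> i < \<sigma> i'"
proof -
  have "Suc i \<le> i'" using assms by simp
  then show ?thesis using assms(5)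
  proof (induction i' rule: dec_induct)
    case base
    have "\<sigma> i \<noteq> \<sigma> (Suc i)" using base assms inj_onD[of \<sigma> "{1..j}" i "Suc i"] by auto
    moreover have "a i \<le> a (Suc i) \<and> (\<sigma> i > \<sigma> (Suc i) \<longrightarrow> a i < a (Suc i))"
      using base assms by (auto simp: dchains_def)
    ultimately show ?case by auto
  next
    case (step m)
    then have "a m \<le> a (Suc m) \<and> (\<sigma> m > \<sigma> (Suc m) \<longrightarrow> a m < a (Suc m))"
      using assms by (auto simp: dchains_def)
    moreover have "\<sigma> m \<noteq> \<sigma> (Suc m)"
      using step assms(2,4) inj_onD[of \<sigma> "{1..j}" m "Suc m"] by auto
    ultimately show ?case using step by auto
  qed
qed

text \<open>Classification by the last entry v; a descent just before it bounds the earlier entries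
  by v - 1. The value at 0 prevents a spurious descent in front of the first entry, that is, for j =
  0.\<close>

lemma dchains_Suc:
  assumes "\<sigma> 0 = 0"
  shows "card (dchains \<sigma> (Suc j) k) =
    (\<Sum>v\<le>k. if \<sigma> j > \<sigma> (Suc j) then (if v = 0 then 0 else card (dchains \<sigma> j (v - 1))) else card (dchains \<sigma> j v))"
    (is "_ = (\<Sum>v\<le>k. ?c v)")
proof -
  define W where "W v = (if \<sigma> j > \<sigma> (Suc j) then (if v = 0 then {} else dchains \<sigma> j (v - 1)) else dchains \<sigma> j v)" for v
  have bound: "a i \<le> a j" if "\<forall>i\<in>{1..<j}. a i \<le> a (Suc i)" "i \<in> {1..j}" for a :: "nat \<Rightarrow> nat" and i
  proof -
    have "i \<le> j \<Longrightarrow> j \<le> j \<Longrightarrow> a i \<le> a j"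
    proof (rule dec_induct[where P = "\<lambda>m. m \<le> j \<longrightarrow> a i \<le> a m", THEN mp])
      fix m assume "i \<le> m" "m < j" "m \<le> j \<longrightarrow> a i \<le> a m"
      moreover from this have "a m \<le> a (Suc m)" using that by auto
      ultimately show "Suc m \<le> j \<longrightarrow> a i \<le> a (Suc m)" by linarith
    qed auto
    then show ?thesis using that by simp
  qed
  \<comment> \<open>For j \<ge> 1 the bound on all entries amounts to a bound on the last one; for j
    = 0 there is no such entry, hence the guard.\<close>
  have Wv: "W v = {a \<in> {1..j} \<rightarrow>\<^sub>E UNIV. (j \<ge> 1 \<longrightarrow> a j \<le> v \<and> (\<sigma> j > \<sigma> (Suc j) \<longrightarrow> a j < v)) \<and>
     (\<forall>i\<in>{1..<j}. a i \<le> a (Suc i) \<and> (\<sigma> i > \<sigma> (Suc i) \<longrightarrow> a i < a (Suc i)))}" for v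
  proof (cases "j = 0")
    case True
    then show ?thesis using assms by (auto simp: W_def dchains_def)
  next
    case False
    have ch: "dchains \<sigma> j u = {a \<in> {1..j} \<rightarrow>\<^sub>E UNIV. a j \<le> u \<and>
       (\<forall>i\<in>{1..<j}. a i \<le> a (Suc i) \<and> (\<sigma> i > \<sigma> (Suc i) \<longrightarrow> a i < a (Suc i)))}" for u
    proof (intro set_eqI iffI)
      fix a assume a: "a \<in> {a \<in> {1..j} \<rightarrow>\<^sub>E UNIV. a j \<le> u \<and>
       (\<forall>i\<in>{1..<j}. a i \<le> a (Suc i) \<and> (\<sigma> i > \<sigma> (Suc i) \<longrightarrow> a i < a (Suc i)))}"
      have "a i \<le> u" if "i \<in> {1..j}" for i
      proof -
        have "a i \<le> a j" using bound[of a i] a that by blast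
        also have "a j \<le> u" using a by blast
        finally show ?thesis .
      qed
      with a show "a \<in> dchains \<sigma> j u" by (auto simp: dchains_def PiE_iff)
    next
      fix a assume "a \<in> dchains \<sigma> j u"
      then show "a \<in> {a \<in> {1..j} \<rightarrow>\<^sub>E UNIV. a j \<le> u \<and>
       (\<forall>i\<in>{1..<j}. a i \<le> a (Suc i) \<and> (\<sigma> i > \<sigma> (Suc i) \<longrightarrow> a i < a (Suc i)))}"
        using False by (auto simp: dchains_def PiE_iff)
    qed
    show ?thesis using False by (auto simp: W_def ch)
  qed
  have "bij_betw (\<lambda>(v, a). a(Suc j := v)) (SIGMA v:{..k}. W v) (dchains \<sigma> (Suc j) k)"
  proof (rule bij_betw_byWitness[where f' = "\<lambda>a. (a (Suc j), a(Suc j := undefined))"])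
    show "\<forall>x\<in>SIGMA v:{..k}. W v. (\<lambda>a. (a (Suc j), a(Suc j := undefined))) ((\<lambda>(v, a). a(Suc j := v)) x) = x"
    proof
      fix x assume x: "x \<in> (SIGMA v:{..k}. W v)"
      obtain v a where [simp]: "x = (v, a)" by force
      have "a (Suc j) = undefined" using x by (simp add: Wv PiE_iff extensional_def)
      then have "a(Suc j := undefined) = a" by (metis fun_upd_triv)
      then show "(\<lambda>a. (a (Suc j), a(Suc j := undefined))) ((\<lambda>(v, a). a(Suc j := v)) x) = x" by simp
    qed
    show "\<forall>a\<in>dchains \<sigma> (Suc j) k. (\<lambda>(v, a). a(Suc j := v)) (a (Suc j), a(Suc j := undefined)) = a"
      by simp
    show "(\<lambda>(v, a). a(Suc j := v)) ` (SIGMA v:{..k}. W v) \<subseteq> dchains \<sigma> (Suc j) k"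
    proof (clarsimp)
      fix v a assume v: "v \<le> k" and a: "a \<in> W v"
      have le: "a i \<le> v" if "i \<in> {1..j}" for i
      proof -
        have "a i \<le> a j" using bound[of a i] a that by (simp add: Wv)
        also have "a j \<le> v" using a that by (simp add: Wv)
        finally show ?thesis .
      qed
      show "a(Suc j := v) \<in> dchains \<sigma> (Suc j) k" unfolding dchains_def
      proof (intro CollectI conjI ballI)
        show "a(Suc j := v) \<in> {1..Suc j} \<rightarrow>\<^sub>E {..k}"
          using a v le le_trans[OF le v] by (auto simp: Wv PiE_iff extensional_def)
      next
        fix i assume "i \<in> {1..<Suc j}"
        then show "(a(Suc j := v)) i \<le> (a(Suc j := v)) (Suc i)"
          "\<sigma> (Suc i) < \<sigma> i \<longrightarrow> (a(Suc j := v)) i < (a(Suc j := v)) (Suc i)"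
          using a by (cases "i = j"; auto simp: Wv)+
      qed
    qed
    show "(\<lambda>a. (a (Suc j), a(Suc j := undefined))) ` dchains \<sigma> (Suc j) k \<subseteq> (SIGMA v:{..k}. W v)"
      by (auto simp: dchains_def Wv PiE_iff extensional_def)
  qed
  from bij_betw_same_card[OF this] have "card (dchains \<sigma> (Suc j) k) = card (SIGMA v:{..k}. W v)" ..
  also have "\<dots> = (\<Sum>v\<le>k. card (W v))"
    by (rule card_SigmaI) (auto simp: W_def finite_dchains)
  also have "\<dots> = (\<Sum>v\<le>k. ?c v)" by (rule sum.cong) (auto simp: W_def)
  finally show ?thesis .
qed

lemma one_minus_X_times_partial_sums:
  "(1 - fps_X) * Abs_fps (\<lambda>k. \<Sum>v\<le>k. t v) = (Abs_fps t :: int fps)"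
proof (rule fps_ext)
  fix k show "((1 - fps_X) * Abs_fps (\<lambda>k. \<Sum>v\<le>k. t v)) $ k = Abs_fps t $ k"
    by (cases k) (simp_all add: left_diff_distrib)
qed

text \<open>Summation over the last entry gives a factor 1/(1 - z) for each entry, and the index
  shift at a descent gives a factor z. The additional factor comes from the sum over k.\<close>

lemma dchains_gf:
  assumes "\<sigma> 0 = 0"
  shows "(1 - fps_X) ^ Suc j * Abs_fps (\<lambda>k. int (card (dchains \<sigma> j k))) =
    fps_X ^ card {i \<in> {1..<j}. \<sigma> i > \<sigma> (Suc i)}"
proof (induction j)
  case 0
  have "dchains \<sigma> 0 k = {\<lambda>_. undefined}" for k by (auto simp: dchains_def)
  then show ?case
    using one_minus_X_times_partial_sums[of "\<lambda>v. if v = 0 then 1 else 0"]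
    by (simp add: fps_one_def)
next
  case (Suc j)
  let ?d = "if \<sigma> j > \<sigma> (Suc j) then 1 else 0 :: nat"
  have "(1 - fps_X) * Abs_fps (\<lambda>k. int (card (dchains \<sigma> (Suc j) k))) =
    fps_X ^ ?d * Abs_fps (\<lambda>k. int (card (dchains \<sigma> j k)))"
    unfolding dchains_Suc[of \<sigma>, OF assms] of_nat_sum one_minus_X_times_partial_sums
    by (auto simp: fps_eq_iff)
  then have "(1 - fps_X) ^ Suc (Suc j) * Abs_fps (\<lambda>k. int (card (dchains \<sigma> (Suc j) k))) =
    fps_X ^ ?d * ((1 - fps_X) ^ Suc j * Abs_fps (\<lambda>k. int (card (dchains \<sigma> j k))))"
    by (simp add: mult_ac)
  also have "\<dots> = fps_X ^ (?d + card {i \<in> {1..<j}. \<sigma> i > \<sigma> (Suc i)})"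
    by (simp only: Suc.IH power_add)
  also have "?d + card {i \<in> {1..<j}. \<sigma> i > \<sigma> (Suc i)} = card {i \<in> {1..<Suc j}. \<sigma> i > \<sigma> (Suc i)}"
  proof (cases "\<sigma> j > \<sigma> (Suc j)")
    case True
    then have "j \<ge> 1" using assms by (cases j) auto
    then have "{i \<in> {1..<Suc j}. \<sigma> i > \<sigma> (Suc i)} = insert j {i \<in> {1..<j}. \<sigma> i > \<sigma> (Suc i)}"
      using True by auto
    then show ?thesis using True by simp
  next
    case False
    then have "{i \<in> {1..<Suc j}. \<sigma> i > \<sigma> (Suc i)} = {i \<in> {1..<j}. \<sigma> i > \<sigma> (Suc i)}"
      by (auto simp: less_Suc_eq)
    then show ?thesis using False by simp
  qed
  finally show ?case .
qed

section \<open>Linear extensions and the decomposition of order-preserving maps\<close>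

definition linear_extensions :: "nat \<Rightarrow> (nat \<Rightarrow> nat \<Rightarrow> bool) \<Rightarrow> (nat \<Rightarrow> nat) set" where
  "linear_extensions n P = {\<sigma>. \<sigma> permutes {1..n} \<and>
     (\<forall>i\<in>{1..n}. \<forall>j\<in>{1..n}. P i j \<longrightarrow> inv \<sigma> i < inv \<sigma> j)}"

text \<open>The set of values is a parameter because inside a chord of value j only the values from
  j on are available.\<close>

definition order_maps :: "'b set \<Rightarrow> ('b \<Rightarrow> 'b \<Rightarrow> bool) \<Rightarrow> nat set \<Rightarrow> ('b \<Rightarrow> nat) set" where
  "order_maps A P K = {f \<in> A \<rightarrow>\<^sub>E K. \<forall>x\<in>A. \<forall>y\<in>A. P x y \<longrightarrow> f x \<le> f y}"

lemma key_less_iff: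
  fixes f :: "nat \<Rightarrow> nat"
  assumes "x \<le> n" "y \<le> n"
  shows "f x * Suc n + x < f y * Suc n + y \<longleftrightarrow> f x < f y \<or> f x = f y \<and> x < y"
proof -
  have *: "f a * Suc n + a < f b * Suc n + b" if "f a < f b" "a \<le> n" for a b
  proof -
    have "Suc (f a) * Suc n \<le> f b * Suc n" using that by (intro mult_le_mono1) simp
    then show ?thesis using that by simp
  qed
  show ?thesis using *[of x y] *[of y x] assms by (cases "f x" "f y" rule: linorder_cases) auto
qed

text \<open>An order-preserving map is sent to the permutation that sorts the points by value, ties being
  broken by position; the keys encode this lexicographic order.\<close>

lemma card_order_maps_eq_sum_dchains:
  assumes P: "\<And>i j. i \<in> {1..n} \<Longrightarrow> j \<in> {1..n} \<Longrightarrow> P i j \<Longrightarrow> i < j"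
  shows "card (order_maps {1..n} P {..k}) = (\<Sum>\<sigma>\<in>linear_extensions n P. card (dchains \<sigma> n k))"
proof -
  define key where "key f x = f x * Suc n + x" for f :: "nat \<Rightarrow> nat" and x
  have key: "key f x < key f y \<longleftrightarrow> f x < f y \<or> f x = f y \<and> x < y" if "x \<in> {1..n}" "y \<in> {1..n}" for f x y
    using key_less_iff[of x n y f] that by (simp add: key_def)
  have key_inj: "inj_on (key f) {1..n}" for f
    by (rule linorder_inj_onI') (metis key linorder_neqE_nat order_less_irrefl)
  define \<Phi> where "\<Phi> = (\<lambda>(\<sigma>, a). restrict (a \<circ> inv (\<sigma> :: nat \<Rightarrow> nat)) {1..n} :: nat \<Rightarrow> nat)"
  have \<Phi>: "restrict (\<Phi> (\<sigma>, a) \<circ> \<sigma>) {1..n} = a" "strict_mono_on {1..n} (key (\<Phi> (\<sigma>, a)) \<circ> \<sigma>)"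
    if "\<sigma> permutes {1..n}" "a \<in> dchains \<sigma> n k" for \<sigma> a
  proof -
    have in_s: "\<sigma> i \<in> {1..n}" if "i \<in> {1..n}" for i
      using permutes_in_image[OF \<open>\<sigma> permutes _\<close>] that by blast
    have eq: "\<Phi> (\<sigma>, a) (\<sigma> i) = a i" if "i \<in> {1..n}" for i
      using in_s[OF that] permutes_inverses(2)[OF \<open>\<sigma> permutes _\<close>] by (simp add: \<Phi>_def)
    show "restrict (\<Phi> (\<sigma>, a) \<circ> \<sigma>) {1..n} = a"
    proof
      fix i show "restrict (\<Phi> (\<sigma>, a) \<circ> \<sigma>) {1..n} i = a i"
        using that(2) eq by (auto simp: dchains_def PiE_iff extensional_def)
    qed
    show "strict_mono_on {1..n} (key (\<Phi> (\<sigma>, a)) \<circ> \<sigma>)"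
    proof (rule strict_mono_onI)
      fix r s assume rs: "r \<in> {1..n}" "s \<in> {1..n}" "r < s"
      have "inj_on \<sigma> {1..n}" using that(1) by (rule permutes_inj_on)
      then have "a r < a s \<or> a r = a s \<and> \<sigma> r < \<sigma> s"
        using dchains_mono[OF that(2), of r s] rs by auto
      then show "(key (\<Phi> (\<sigma>, a)) \<circ> \<sigma>) r < (key (\<Phi> (\<sigma>, a)) \<circ> \<sigma>) s"
        using rs by (simp add: key[OF in_s in_s] eq)
    qed
  qed
  have "bij_betw \<Phi> (SIGMA \<sigma>:linear_extensions n P. dchains \<sigma> n k) (order_maps {1..n} P {..k})"
  proof (rule bij_betw_imageI)
    show "inj_on \<Phi> (SIGMA \<sigma>:linear_extensions n P. dchains \<sigma> n k)"
    proof (rule inj_onI)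
      fix x y assume x: "x \<in> (SIGMA \<sigma>:linear_extensions n P. dchains \<sigma> n k)"
        and y: "y \<in> (SIGMA \<sigma>:linear_extensions n P. dchains \<sigma> n k)" and xy: "\<Phi> x = \<Phi> y"
      obtain \<sigma> a \<tau> b where [simp]: "x = (\<sigma>, a)" "y = (\<tau>, b)" by fastforce
      have p: "\<sigma> permutes {1..n}" "a \<in> dchains \<sigma> n k" "\<tau> permutes {1..n}" "b \<in> dchains \<tau> n k"
        using x y by (auto simp: linear_extensions_def)
      have eq: "\<Phi> (\<tau>, b) = \<Phi> (\<sigma>, a)" using xy by simp
      \<comment> \<open>Both permutations sort the keys of one and the same map, so they
        coincide.\<close>
      have "\<sigma> = \<tau>"
        using sorting_permutation_ex1[OF key_inj[of "\<Phi> (\<sigma>, a)"]]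
          conjI[OF p(1) \<Phi>(2)[OF p(1,2)]] conjI[OF p(3) \<Phi>(2)[OF p(3,4), unfolded eq]]
        by blast
      moreover from this have "a = b"
        using \<Phi>(1)[OF p(1,2)] \<Phi>(1)[OF p(3,4), unfolded eq] by (simp only:)
      ultimately show "x = y" by simp
    qed
    show "\<Phi> ` (SIGMA \<sigma>:linear_extensions n P. dchains \<sigma> n k) = order_maps {1..n} P {..k}"
    proof (intro set_eqI iffI)
      fix f assume "f \<in> \<Phi> ` (SIGMA \<sigma>:linear_extensions n P. dchains \<sigma> n k)"
      then obtain \<sigma> a where s: "\<sigma> \<in> linear_extensions n P" "a \<in> dchains \<sigma> n k" "f = \<Phi> (\<sigma>, a)" by auto
      then have perm: "\<sigma> permutes {1..n}" by (simp add: linear_extensions_def)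
      have inv_in: "inv \<sigma> i \<in> {1..n}" if "i \<in> {1..n}" for i
        using permutes_in_image[OF permutes_inv[OF perm]] that by blast
      have fi: "f i = a (inv \<sigma> i)" if "i \<in> {1..n}" for i using that s by (simp add: \<Phi>_def)
      have "f \<in> {1..n} \<rightarrow>\<^sub>E {..k}"
        using s(2,3) inv_in by (auto simp: dchains_def \<Phi>_def)
      moreover have "f i \<le> f j" if ij: "i \<in> {1..n}" "j \<in> {1..n}" "P i j" for i j
      proof -
        have "inv \<sigma> i < inv \<sigma> j" using s(1) ij by (auto simp: linear_extensions_def)
        then have "a (inv \<sigma> i) \<le> a (inv \<sigma> j)"
          using dchains_mono[OF s(2) permutes_inj_on[OF perm], of "inv \<sigma> i" "inv \<sigma> j"]
            inv_in[OF ij(1)] inv_in[OF ij(2)] by auto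
        then show ?thesis using fi ij by simp
      qed
      ultimately show "f \<in> order_maps {1..n} P {..k}" by (auto simp: order_maps_def)
    next
      fix f assume f: "f \<in> order_maps {1..n} P {..k}"
      obtain \<sigma> where s: "\<sigma> permutes {1..n}" "strict_mono_on {1..n} (key f \<circ> \<sigma>)"
        using sorting_permutation_ex1[OF key_inj[of f]] by blast
      have in_s: "\<sigma> i \<in> {1..n}" if "i \<in> {1..n}" for i
        using permutes_in_image[OF s(1)] that by blast
      have inv_in: "inv \<sigma> i \<in> {1..n}" if "i \<in> {1..n}" for i
        using permutes_in_image[OF permutes_inv[OF s(1)]] that by blast
      define a where "a = restrict (f \<circ> \<sigma>) {1..n}"
      have "a \<in> {1..n} \<rightarrow>\<^sub>E {..k}" using f in_s by (auto simp: a_def order_maps_def PiE_iff)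
      moreover have "a i \<le> a (Suc i) \<and> (\<sigma> (Suc i) < \<sigma> i \<longrightarrow> a i < a (Suc i))" if "i \<in> {1..<n}" for i
      proof -
        have "key f (\<sigma> i) < key f (\<sigma> (Suc i))"
          using strict_mono_onD[OF s(2), of i "Suc i"] that by auto
        then show ?thesis using that in_s[of i] in_s[of "Suc i"] by (auto simp: key a_def)
      qed
      ultimately have a: "a \<in> dchains \<sigma> n k" by (auto simp: dchains_def)
      have "inv \<sigma> i < inv \<sigma> j" if ij: "i \<in> {1..n}" "j \<in> {1..n}" "P i j" for i j
      proof (rule ccontr)
        assume "\<not> inv \<sigma> i < inv \<sigma> j"
        moreover have "inv \<sigma> i \<noteq> inv \<sigma> j"
          using P[OF ij] permutes_inverses(1)[OF s(1)] by (metis less_irrefl)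
        ultimately have "key f j < key f i"
          using strict_mono_onD[OF s(2) inv_in[OF ij(2)] inv_in[OF ij(1)]] permutes_inverses(1)[OF s(1)]
          by simp
        \<comment> \<open>If f i = f j, the labels decide; i < j because the labelling of the points
          is itself compatible with P.\<close>
        moreover have "key f i < key f j" using f ij P[OF ij] by (auto simp: key order_maps_def le_less)
        ultimately show False by simp
      qed
      then have "\<sigma> \<in> linear_extensions n P" using s by (auto simp: linear_extensions_def)
      moreover have "\<Phi> (\<sigma>, a) = f"
      proof
        fix i show "\<Phi> (\<sigma>, a) i = f i"
          using f inv_in permutes_inverses(1)[OF s(1)]
          by (auto simp: \<Phi>_def a_def order_maps_def PiE_iff extensional_def)
      qed
      ultimately show "f \<in> \<Phi> ` (SIGMA \<sigma>:linear_extensions n P. dchains \<sigma> n k)" using a by force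
    qed
  qed
  from bij_betw_same_card[OF this] show ?thesis
    by (subst (asm) card_SigmaI)
      (auto simp: linear_extensions_def finite_dchains intro: finite_subset[OF _ finite_permutations[of "{1..n}"]])
qed

lemma order_maps_gf:
  assumes P: "\<And>i j. i \<in> {1..n} \<Longrightarrow> j \<in> {1..n} \<Longrightarrow> P i j \<Longrightarrow> i < j"
  shows "(1 - fps_X) ^ Suc n * Abs_fps (\<lambda>k. int (card (order_maps {1..n} P {..k}))) =
    (\<Sum>\<sigma>\<in>linear_extensions n P. fps_X ^ des n \<sigma>)"
proof -
  have "Abs_fps (\<lambda>k. int (card (order_maps {1..n} P {..k}))) =
    (\<Sum>\<sigma>\<in>linear_extensions n P. Abs_fps (\<lambda>k. int (card (dchains \<sigma> n k))))"
    by (rule fps_ext)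
      (simp only: card_order_maps_eq_sum_dchains[of n P, OF P] fps_nth_Abs_fps fps_sum_nth of_nat_sum)
  moreover have "(1 - fps_X) ^ Suc n * Abs_fps (\<lambda>k. int (card (dchains \<sigma> n k))) = fps_X ^ des n \<sigma>"
    if "\<sigma> \<in> linear_extensions n P" for \<sigma>
  proof -
    have "\<sigma> 0 = 0" using that permutes_not_in by (force simp: linear_extensions_def)
    from dchains_gf[of \<sigma>, OF this] show ?thesis by (simp only: des_def Suc_eq_plus1)
  qed
  ultimately show ?thesis by (simp only: sum_distrib_left) (rule sum.cong, auto)
qed

section \<open>Dyck words as binary trees\<close>

fun word :: "dtree \<Rightarrow> step list" where
  "word Leaf = []"
| "word (Node u v) = Up # word u @ Down # word v"

lemma length_word [simp]: "length (word w) = 2 * size w"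
  by (induction w) auto

lemma height_0 [simp]: "height p 0 = 0"
  by (simp add: height_def)

lemma height_append: "height (a @ b) k = height a k + height b (k - length a)"
  by (simp add: height_def)

lemma height_Cons: "height (s # p) k = (if k = 0 then 0 else (case s of Up \<Rightarrow> 1 | Down \<Rightarrow> - 1) + height p (k - 1))"
  by (cases k) (simp_all add: height_def)

lemma height_Nil [simp]: "height [] k = 0"
  by (simp add: height_def)

lemma height_ge_length: "length p \<le> k \<Longrightarrow> height p k = height p (length p)"
  by (simp add: height_def)

lemma height_word_end [simp]: "2 * size w \<le> k \<Longrightarrow> height (word w) k = 0"
  by (induction w arbitrary: k) (auto simp: height_append height_Cons)

lemma height_word_nonneg: "0 \<le> height (word w) k"
proof (induction w arbitrary: k)
  case (Node u v)
  show ?case using Node(1)[of "k - 1"] Node(2)[of "k - 2 - 2 * size u"]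
    by (auto simp: height_append height_Cons)
qed simp

text \<open>First-return decomposition by strong induction. After an initial \<open>Up\<close> the
  rest falls below -1, so it splits off \<open>word u\<close> and a \<open>Down\<close>; since
  \<open>word u\<close> stays nonnegative, the remainder still falls below 0 and splits off
  \<open>word v\<close>.\<close>

lemma word_prefix_before_negative:
  "k \<le> length p \<Longrightarrow> height p k < 0 \<Longrightarrow> \<exists>w r. p = word w @ Down # r"
proof (induction "length p" arbitrary: p k rule: less_induct)
  case less
  show ?case
  proof (cases p)
    case Nil
    then show ?thesis using less by simp
  next
    case (Cons s p')
    show ?thesis
    proof (cases s)
      case Down
      then show ?thesis using Cons by (intro exI[of _ Leaf]) simp
    next
      case Up
      have "k \<noteq> 0" using less.prems by (cases k) auto
      then have "height p' (k - 1) < - 1" "k - 1 \<le> length p'" using less.prems Cons Up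
        by (auto simp: height_Cons)
      then obtain u q where q: "p' = word u @ Down # q"
        using less.hyps[of p' "k - 1"] Cons by auto
      define m where "m = k - 2 - 2 * size u"
      have "height q m < 0" "m \<le> length q"
        using \<open>height p' (k - 1) < - 1\<close> \<open>k - 1 \<le> length p'\<close> height_word_nonneg[of u "k - 1"]
        by (auto simp: q height_append height_Cons m_def split: if_splits)
      then obtain v r where "q = word v @ Down # r"
        using less.hyps[of q m] Cons q by auto
      then have "p = word (Node u v) @ Down # r" using Cons Up q by simp
      then show ?thesis by blast
    qed
  qed
qed

lemma dyck_path_word:
  assumes "dyck_path n p" obtains w where "p = word w" "n = size w"
proof -
  have len: "length p = 2 * n" and end0: "height p (2 * n) = 0" and nn: "\<And>k. k \<le> 2 * n \<Longrightarrow> height p k \<ge> 0"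
    using assms by (auto simp: dyck_path_def)
  \<comment> \<open>The appended \<open>Down\<close> forces the balanced path below the axis. The
    resulting split must use exactly this step, as an earlier one would make p itself
    negative.\<close>
  have "height (p @ [Down]) (2 * n + 1) < 0"
    using height_ge_length[of p "2 * n + 1"] by (simp add: height_append height_Cons len end0)
  then obtain w r where wr: "p @ [Down] = word w @ Down # r"
    using word_prefix_before_negative[of "2 * n + 1" "p @ [Down]"] len by auto
  show thesis
  proof (cases r rule: rev_cases)
    case Nil
    then show thesis using wr len that[of w] by simp
  next
    case (snoc r' x)
    then have p: "p = word w @ Down # r'" using wr by simp
    then have "height p (2 * size w + 1) < 0" by (simp add: height_append height_Cons)
    moreover have "2 * size w + 1 \<le> 2 * n" using p len by simp
    ultimately show thesis using nn by fastforce
  qed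
qed

section \<open>Chords of a word read off its tree\<close>

definition is_chord :: "step list \<Rightarrow> nat \<Rightarrow> nat \<Rightarrow> bool" where
  "is_chord p i j \<longleftrightarrow> 1 \<le> i \<and> i < j \<and> j \<le> length p \<and> step_at p i = Up \<and> step_at p j = Down \<and>
     height p j = height p (i - 1) \<and> (\<forall>k. i \<le> k \<and> k < j \<longrightarrow> height p (i - 1) < height p k)"

fun tree_chords :: "dtree \<Rightarrow> nat \<Rightarrow> (nat \<times> nat) set" where
  "tree_chords Leaf s = {}"
| "tree_chords (Node u v) s =
     insert (Suc s, s + 2 + 2 * size u) (tree_chords u (Suc s) \<union> tree_chords v (s + 2 + 2 * size u))"

lemma tree_chords_bounds:
  "(i, j) \<in> tree_chords w s \<Longrightarrow> s < i \<and> i < j \<and> j \<le> s + 2 * size w"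
proof (induction w arbitrary: s)
  case (Node u v)
  show ?case using Node.prems Node.IH(1)[of "Suc s"] Node.IH(2)[of "s + 2 + 2 * size u"] by auto
qed simp

lemma height_word_middle:
  "height (a @ word w @ b) (length a + k) =
     height a (length a) + height (word w) k + height b (k - 2 * size w)"
  using height_ge_length[of a "length a + k"] by (simp add: height_append)

text \<open>The surrounding lists make the induction work: a subword sits inside a larger path, and
  \<open>tree_chords\<close> sees the context only through the offset
  \<open>length a\<close>.\<close>

lemma tree_chords_sound:
  "(i, j) \<in> tree_chords w (length a) \<Longrightarrow> is_chord (a @ word w @ b) i j"
proof (induction w arbitrary: a b)
  case (Node u v)
  let ?p = "a @ word (Node u v) @ b"
  consider "i = Suc (length a)" "j = length a + 2 + 2 * size u"
    | "(i, j) \<in> tree_chords u (length (a @ [Up]))"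
    | "(i, j) \<in> tree_chords v (length (a @ Up # word u @ [Down]))"
    using Node.prems by auto
  then show ?case
  proof cases
    case 1
    have "height ?p (length a) < height ?p k" if k: "i \<le> k" "k < j" for k
    proof -
      obtain d where d: "k = length a + Suc d" using 1 k less_iff_Suc_add[of "length a" k] by auto
      then have "d \<le> 2 * size u" using 1 k by simp
      then show ?thesis using height_word_nonneg[of u d] unfolding d height_word_middle
        using height_word_middle[of a "Node u v" b 0]
        by (simp add: height_append height_Cons)
    qed
    moreover have "height ?p j = height ?p (length a)"
      using height_word_middle[of a "Node u v" b "2 + 2 * size u"] height_word_middle[of a "Node u v" b 0] 1
      by (simp add: height_append height_Cons add.assoc)
    ultimately show ?thesis using 1 by (auto simp: is_chord_def step_at_def nth_append)
  next
    case 2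
    from Node.IH(1)[OF this, of "Down # word v @ b"] show ?thesis by simp
  next
    case 3
    from Node.IH(2)[OF this, of b] show ?thesis by simp
  qed
qed simp

text \<open>Supplies the converse inclusion in \<open>chords_word\<close>: the partner found here
  must, by \<open>is_chord_unique\<close>, be the partner in the given chord. It later yields the
  chord through an arbitrary step.\<close>

lemma tree_chords_complete:
  fixes a :: "step list"
  assumes "length a < i" "i \<le> length a + 2 * size w"
  shows "\<exists>j. (i, j) \<in> tree_chords w (length a) \<or> (j, i) \<in> tree_chords w (length a)"
  using assms
proof (induction w arbitrary: a)
  case (Node u v)
  let ?a = "a @ [Up]" and ?a' = "a @ Up # word u @ [Down]"
  consider "i = Suc (length a)" | "i = length a + 2 + 2 * size u"
    | "length ?a < i" "i \<le> length ?a + 2 * size u" | "length ?a' < i" "i \<le> length ?a' + 2 * size v"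
    using Node.prems by fastforce
  then show ?case
  proof cases
    case 3
    then show ?thesis using Node.IH(1)[of ?a] by auto
  next
    case 4
    then show ?thesis using Node.IH(2)[of ?a'] by auto
  qed auto
qed simp

lemma is_chord_unique: "is_chord p i j \<Longrightarrow> is_chord p i j' \<Longrightarrow> j = j'"
proof -
  have False if "is_chord p i j" "is_chord p i j'" "j < j'" for j j'
    using that unfolding is_chord_def by (metis less_imp_le_nat less_irrefl)
  then show "is_chord p i j \<Longrightarrow> is_chord p i j' \<Longrightarrow> j = j'" by (metis linorder_neqE_nat)
qed

lemma chords_word: "chords (size w) (word w) = tree_chords w 0"
proof -
  have "chords (size w) (word w) = {(i, j). is_chord (word w) i j}"
    by (auto simp: chords_def is_chord_def)
  also have "\<dots> = tree_chords w 0"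
  proof (intro set_eqI iffI; clarify)
    fix i j assume ij: "is_chord (word w) i j"
    then obtain j' where j': "(i, j') \<in> tree_chords w 0 \<or> (j', i) \<in> tree_chords w 0"
      using tree_chords_complete[of "[]" i w] by (auto simp: is_chord_def)
    have "(j', i) \<notin> tree_chords w 0"
      using ij tree_chords_sound[of j' i w "[]" "[]"] by (auto simp: is_chord_def)
    then have "(i, j') \<in> tree_chords w 0" using j' by simp
    moreover from this have "j = j'"
      using ij is_chord_unique tree_chords_sound[of i j' w "[]" "[]"] by simp
    ultimately show "(i, j) \<in> tree_chords w 0" by simp
  next
    fix i j assume "(i, j) \<in> tree_chords w 0"
    then show "is_chord (word w) i j" using tree_chords_sound[of i j w "[]" "[]"] by simp
  qed
  finally show ?thesis .
qed

lemma tree_chords_disjoint: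
  "tree_chords u (Suc s) \<inter> tree_chords v (s + 2 + 2 * size u) = {}"
  "(Suc s, s + 2 + 2 * size u) \<notin> tree_chords u (Suc s) \<union> tree_chords v (s + 2 + 2 * size u)"
  by (auto dest!: tree_chords_bounds)

lemma finite_tree_chords: "finite (tree_chords w s)"
  by (induction w arbitrary: s) auto

lemma card_tree_chords: "card (tree_chords w s) = size w"
proof (induction w arbitrary: s)
  case (Node u v)
  then show ?case using tree_chords_disjoint[where u = u and s = s and v = v]
    by (simp add: finite_tree_chords card_Un_disjoint)
qed simp

lemma inj_on_fst_tree_chords: "inj_on fst (tree_chords w s)"
proof (rule inj_onI)
  fix x y assume xy: "x \<in> tree_chords w s" "y \<in> tree_chords w s" "fst x = fst y"
  \<comment> \<open>The s up steps serve as a prefix that realizes the offset.\<close>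
  have "is_chord (replicate s Up @ word w @ []) (fst c) (snd c)" if "c \<in> tree_chords w s" for c
    using tree_chords_sound[of "fst c" "snd c" w "replicate s Up" "[]"] that by simp
  from this[OF xy(1)] this[OF xy(2)] have "snd x = snd y"
    unfolding xy(3) by (rule is_chord_unique)
  then show "x = y" using xy(3) by (simp add: prod_eq_iff)
qed

section \<open>Counting order-preserving maps on the chord poset\<close>

lemma card_order_maps_split:
  assumes fin: "finite A" "finite B" and disj: "A \<inter> B = {}" "r \<notin> A \<union> B"
    and "\<not> P r r" and rA: "\<And>x. x \<in> A \<Longrightarrow> P r x \<and> \<not> P x r"
    and rB: "\<And>y. y \<in> B \<Longrightarrow> \<not> P r y \<and> \<not> P y r"
    and AB: "\<And>x y. x \<in> A \<Longrightarrow> y \<in> B \<Longrightarrow> \<not> P x y \<and> \<not> P y x"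
  shows "card (order_maps (insert r (A \<union> B)) P {lo..k}) =
    (\<Sum>j\<in>{lo..k}. card (order_maps A P {j..k})) * card (order_maps B P {lo..k})"
proof -
  define S where "S = (SIGMA j:{lo..k}. order_maps A P {j..k}) \<times> order_maps B P {lo..k}"
  define F where "F = (\<lambda>f :: 'a \<Rightarrow> nat. ((f r, restrict f A), restrict f B))"
  define G where "G = (\<lambda>((j :: nat, g), h) x. if x = r then j else if x \<in> A then g x else h x :: nat)"
  have "bij_betw F (order_maps (insert r (A \<union> B)) P {lo..k}) S"
  proof (rule bij_betw_byWitness[where f' = G])
    show "\<forall>f\<in>order_maps (insert r (A \<union> B)) P {lo..k}. G (F f) = f"
    proof
      fix f assume f: "f \<in> order_maps (insert r (A \<union> B)) P {lo..k}"
      show "G (F f) = f"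
      proof
        fix x show "G (F f) x = f x"
          using f disj by (auto simp: F_def G_def order_maps_def PiE_iff extensional_def)
      qed
    qed
    show "\<forall>t\<in>S. F (G t) = t"
    proof
      fix t assume t: "t \<in> S"
      obtain j g h where [simp]: "t = ((j, g), h)" by (metis surj_pair)
      have g: "g \<in> A \<rightarrow>\<^sub>E {j..k}" and h: "h \<in> B \<rightarrow>\<^sub>E {lo..k}" using t by (auto simp: S_def order_maps_def)
      have "restrict (G t) A = g"
      proof
        fix x show "restrict (G t) A x = g x"
          using g disj by (auto simp: G_def PiE_iff extensional_def)
      qed
      moreover have "restrict (G t) B = h"
      proof
        fix x show "restrict (G t) B x = h x"
          using h disj by (auto simp: G_def PiE_iff extensional_def)
      qed
      ultimately show "F (G t) = t" by (simp add: F_def) (simp add: G_def)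
    qed
    show "F ` order_maps (insert r (A \<union> B)) P {lo..k} \<subseteq> S"
      using rA by (auto simp: F_def S_def order_maps_def PiE_iff)
    show "G ` S \<subseteq> order_maps (insert r (A \<union> B)) P {lo..k}"
    proof
      fix f assume "f \<in> G ` S"
      then obtain j g h where f: "f = G ((j, g), h)" and j: "lo \<le> j" "j \<le> k"
        and g: "g \<in> order_maps A P {j..k}" and h: "h \<in> order_maps B P {lo..k}"
        by (auto simp: S_def)
      have fr: "f r = j" by (simp add: f G_def)
      have fA: "f x = g x" if "x \<in> A" for x using that disj by (auto simp: f G_def)
      have fB: "f x = h x" if "x \<in> B" for x using that disj by (auto simp: f G_def)
      have gk: "j \<le> g x \<and> g x \<le> k" if "x \<in> A" for x using g that by (auto simp: order_maps_def PiE_iff)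
      have hk: "lo \<le> h x \<and> h x \<le> k" if "x \<in> B" for x using h that by (auto simp: order_maps_def PiE_iff)
      have "f x = undefined" if "x \<notin> insert r (A \<union> B)" for x
        using that h by (auto simp: f G_def order_maps_def PiE_iff extensional_def)
      moreover have "f x \<in> {lo..k}" if "x \<in> insert r (A \<union> B)" for x
        using that fr fA fB gk[of x] hk[of x] j by auto
      moreover have "f x \<le> f y" if xy: "x \<in> insert r (A \<union> B)" "y \<in> insert r (A \<union> B)" "P x y" for x y
      proof -
        consider "x = r" "y \<in> A" | "x \<in> A" "y \<in> A" | "x \<in> B" "y \<in> B"
          using xy assms(5) rA rB AB by blast
        then show ?thesis
          by cases (use fr fA fB gk g h xy in \<open>auto simp: order_maps_def\<close>)
      qed
      ultimately show "f \<in> order_maps (insert r (A \<union> B)) P {lo..k}"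
        by (auto simp: order_maps_def PiE_iff extensional_def)
    qed
  qed
  from bij_betw_same_card[OF this] have "card (order_maps (insert r (A \<union> B)) P {lo..k}) = card S" .
  also have "\<dots> = (\<Sum>j\<in>{lo..k}. card (order_maps A P {j..k})) * card (order_maps B P {lo..k})"
  proof -
    have "finite (order_maps A P {j..k})" for j
      by (rule finite_subset[OF _ finite_PiE[OF fin(1), of "\<lambda>_. {j..k}"]]) (auto simp: order_maps_def)
    then show ?thesis unfolding S_def by (simp add: card_cartesian_product)
  qed
  finally show ?thesis .
qed

text \<open>The bound \<open>lo\<close> is there for the induction, since the chords below a root of
  value j range over {j..k}. Only the number of values matters, and j -> k - j produces the sum in
  \<open>omega\<close>.\<close>

lemma card_order_maps_tree_chords:
  "lo \<le> k \<Longrightarrow> card (order_maps (tree_chords w s) chord_less {lo..k}) = omega w (k - lo)"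
proof (induction w arbitrary: s lo)
  case Leaf
  have "order_maps {} chord_less {lo..k} = {\<lambda>_. undefined}" by (auto simp: order_maps_def)
  then show ?case by simp
next
  case (Node u v)
  let ?A = "tree_chords u (Suc s)" and ?B = "tree_chords v (s + 2 + 2 * size u)" and ?r = "(Suc s, s + 2 + 2 * size u)"
  have bA: "Suc s < fst x \<and> fst x < snd x \<and> snd x < s + 2 + 2 * size u" if "x \<in> ?A" for x
    using tree_chords_bounds[of "fst x" "snd x" u "Suc s"] that by auto
  have bB: "s + 2 + 2 * size u < fst x \<and> fst x < snd x" if "x \<in> ?B" for x
    using tree_chords_bounds[of "fst x" "snd x" v "s + 2 + 2 * size u"] that by auto
  have "card (order_maps (tree_chords (Node u v) s) chord_less {lo..k}) =
     (\<Sum>j\<in>{lo..k}. card (order_maps ?A chord_less {j..k})) * card (order_maps ?B chord_less {lo..k})"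
    unfolding tree_chords.simps
  proof (rule card_order_maps_split)
    show "chord_less ?r x \<and> \<not> chord_less x ?r" if "x \<in> ?A" for x
      using bA[OF that] by (auto simp: chord_less_def)
    show "\<not> chord_less ?r x \<and> \<not> chord_less x ?r" if "x \<in> ?B" for x
      using bB[OF that] by (auto simp: chord_less_def)
    show "\<not> chord_less x y \<and> \<not> chord_less y x" if "x \<in> ?A" "y \<in> ?B" for x y
      using bA[OF that(1)] bB[OF that(2)] by (auto simp: chord_less_def)
  qed (use tree_chords_disjoint in \<open>auto simp: finite_tree_chords chord_less_def\<close>)
  also have "(\<Sum>j\<in>{lo..k}. card (order_maps ?A chord_less {j..k})) = (\<Sum>j\<in>{lo..k}. omega u (k - j))"
    by (rule sum.cong) (auto simp: Node.IH(1))
  also have "\<dots> = (\<Sum>j\<le>k - lo. omega u j)"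
    by (rule sum.reindex_bij_witness[where i = "\<lambda>j. k - j" and j = "\<lambda>j. k - j"]) (use Node.prems in auto)
  finally show ?case using Node by simp
qed

lemma rank_bij_betw:
  fixes A :: "(nat \<times> nat) set"
  assumes "finite A" "inj_on fst A"
  defines "r \<equiv> (\<lambda>c. card {c' \<in> A. fst c' \<le> fst c})"
  shows "bij_betw r A {1..card A}"
    and "\<And>c c'. c \<in> A \<Longrightarrow> c' \<in> A \<Longrightarrow> fst c < fst c' \<Longrightarrow> r c < r c'"
proof -
  show mono: "r c < r c'" if "c \<in> A" "c' \<in> A" "fst c < fst c'" for c c'
    unfolding r_def using that assms(1) by (intro psubset_card_mono) force+
  have inj: "inj_on r A"
  proof (rule inj_onI, rule ccontr)
    fix x y assume "x \<in> A" "y \<in> A" "r x = r y" "x \<noteq> y"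
    then show False using mono[of x y] mono[of y x] assms(2)
      by (metis inj_onD less_irrefl linorder_neqE_nat)
  qed
  have "r ` A \<subseteq> {1..card A}"
    using assms(1) by (force simp: r_def Suc_le_eq card_gt_0_iff intro: card_mono)
  moreover have "card (r ` A) = card {1..card A}" using inj by (simp add: card_image)
  ultimately show "bij_betw r A {1..card A}"
    using inj by (simp add: bij_betw_def card_subset_eq)
qed

text \<open>After renaming chords by \<open>L0\<close>, with inverse \<open>e\<close>, the inverse
  of L0 \<circ> L^(-1) is i -> L (e i), so L is natural iff the permutation is a linear extension.
  \<open>L0\<close> respects the order because an inner chord opens later than an outer one; this
  provides the hypothesis of \<open>order_maps_gf\<close>.\<close>

lemma label_perms_gf:
  "(\<Sum>\<sigma>\<in>label_perms (size w) (word w). fps_X ^ des (size w) \<sigma>) =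
     (1 - fps_X) ^ Suc (size w) * Abs_fps (\<lambda>k. of_nat (omega w k) :: int)"
proof -
  define n C r where "n = size w" and "C = tree_chords w 0" and "r = L0 n (word w)"
  have C: "chords n (word w) = C" by (simp add: n_def C_def chords_word)
  have r_eq: "r = (\<lambda>c. card {c' \<in> C. fst c' \<le> fst c})"
    by (simp add: r_def L0_def fun_eq_iff C)
  have fin: "finite C" and card: "card C = n" and inj: "inj_on fst C"
    by (simp_all add: C_def finite_tree_chords card_tree_chords inj_on_fst_tree_chords n_def)
  have bij: "bij_betw r C {1..n}" using rank_bij_betw(1)[OF fin inj] by (simp add: r_eq card)
  have r_mono: "r c < r c'" if "c \<in> C" "c' \<in> C" "fst c < fst c'" for c c'
    using rank_bij_betw(2)[OF fin inj that] by (simp add: r_eq)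
  define e where "e = inv_into C r"
  have e_in: "e i \<in> C" and re: "r (e i) = i" if "i \<in> {1..n}" for i
    using bij that by (auto simp: e_def bij_betw_def inv_into_into f_inv_into_f)
  have er: "e (r c) = c" and r_in: "r c \<in> {1..n}" if "c \<in> C" for c
    using bij that by (auto simp: e_def bij_betw_def)
  define P where "P i j = chord_less (e i) (e j)" for i j
  have P: "i < j" if "i \<in> {1..n}" "j \<in> {1..n}" "P i j" for i j
    using r_mono[of "e i" "e j"] that by (simp add: P_def chord_less_def e_in re)
  have "label_perms n (word w) = linear_extensions n P"
  proof (intro set_eqI iffI)
    fix \<sigma> assume "\<sigma> \<in> label_perms n (word w)"
    then obtain L where perm: "\<sigma> permutes {1..n}" and L: "natural_labeling n (word w) L"
      and \<sigma>: "\<And>i. i \<in> {1..n} \<Longrightarrow> \<sigma> i = r (inv_into C L i)"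
      by (auto simp: label_perms_def r_def C)
    have bL: "bij_betw L C {1..n}" using L by (simp add: natural_labeling_def C)
    have inv\<sigma>: "inv \<sigma> i = L (e i)" if "i \<in> {1..n}" for i
    proof -
      have "L (e i) \<in> {1..n}" using bL e_in[OF that] by (auto simp: bij_betw_def)
      then have "\<sigma> (L (e i)) = r (e i)"
        using \<sigma> bL e_in[OF that] by (simp add: bij_betw_def)
      then show ?thesis using re[OF that] permutes_inverses(2)[OF perm] by metis
    qed
    show "\<sigma> \<in> linear_extensions n P"
      using perm L e_in by (auto simp: linear_extensions_def natural_labeling_def C inv\<sigma> P_def)
  next
    fix \<sigma> assume \<sigma>: "\<sigma> \<in> linear_extensions n P"
    then have perm: "\<sigma> permutes {1..n}" by (simp add: linear_extensions_def)
    define L where "L = (\<lambda>c. inv \<sigma> (r c))"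
    have "bij_betw (inv \<sigma> \<circ> r) C {1..n}"
      using bij permutes_imp_bij[OF permutes_inv[OF perm]] by (rule bij_betw_trans)
    then have bL: "bij_betw L C {1..n}" by (simp add: L_def comp_def)
    moreover have "L c < L c'" if "c \<in> C" "c' \<in> C" "chord_less c c'" for c c'
      using \<sigma> that r_in er by (auto simp: linear_extensions_def L_def P_def)
    ultimately have "natural_labeling n (word w) L" by (auto simp: natural_labeling_def C)
    moreover have "\<sigma> i = r (inv_into C L i)" if "i \<in> {1..n}" for i
    proof -
      have "L (inv_into C L i) = i" using bL that by (simp add: bij_betw_def f_inv_into_f)
      then show ?thesis using permutes_inverses(1)[OF perm] by (metis L_def)
    qed
    ultimately show "\<sigma> \<in> label_perms n (word w)" using perm by (auto simp: label_perms_def C r_def)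
  qed
  moreover have "card (order_maps {1..n} P {..k}) = omega w k" for k
  proof -
    have "bij_betw (\<lambda>f. restrict (f \<circ> r) C) (order_maps {1..n} P {..k}) (order_maps C chord_less {..k})"
    proof (rule bij_betw_byWitness[where f' = "\<lambda>f. restrict (f \<circ> e) {1..n}"])
      show "\<forall>f\<in>order_maps {1..n} P {..k}. restrict (restrict (f \<circ> r) C \<circ> e) {1..n} = f"
      proof
        fix f assume f: "f \<in> order_maps {1..n} P {..k}"
        show "restrict (restrict (f \<circ> r) C \<circ> e) {1..n} = f"
        proof
          fix i show "restrict (restrict (f \<circ> r) C \<circ> e) {1..n} i = f i"
            using f e_in re by (auto simp: order_maps_def PiE_iff extensional_def)
        qed
      qed
      show "\<forall>f\<in>order_maps C chord_less {..k}. restrict (restrict (f \<circ> e) {1..n} \<circ> r) C = f"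
      proof
        fix f assume f: "f \<in> order_maps C chord_less {..k}"
        show "restrict (restrict (f \<circ> e) {1..n} \<circ> r) C = f"
        proof
          fix c show "restrict (restrict (f \<circ> e) {1..n} \<circ> r) C c = f c"
            using f er r_in[of c] by (cases c) (auto simp: order_maps_def PiE_iff extensional_def)
        qed
      qed
      show "(\<lambda>f. restrict (f \<circ> r) C) ` order_maps {1..n} P {..k} \<subseteq> order_maps C chord_less {..k}"
        using r_in er by (auto simp: order_maps_def PiE_iff P_def)
      show "(\<lambda>f. restrict (f \<circ> e) {1..n}) ` order_maps C chord_less {..k} \<subseteq> order_maps {1..n} P {..k}"
        using e_in by (auto simp: order_maps_def PiE_iff P_def)
    qed
    from bij_betw_same_card[OF this] show ?thesis
      using card_order_maps_tree_chords[of 0 k w 0] by (simp add: C_def atMost_atLeast0)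
  qed
  ultimately show ?thesis using order_maps_gf[of n P, OF P] by (simp add: n_def)
qed

section \<open>Height and crossing data\<close>

text \<open>The number of boxes above the next vertex when the lower path goes up and the upper path
  takes step s; in \<open>lower_step\<close> the lower path goes down. \<open>configs\<close>
  excludes \<open>Down\<close> at p = 0, where the truncated subtraction would be wrong.\<close>

abbreviation upper_step :: "step \<Rightarrow> nat \<Rightarrow> nat" where
  "upper_step s p \<equiv> (if s = Up then p else p - 1)"

abbreviation lower_step :: "step \<Rightarrow> nat \<Rightarrow> nat" where
  "lower_step t q \<equiv> (if t = Up then Suc q else q)"

definition join :: "step \<times> nat \<times> (step list \<times> nat list \<times> nat) \<times> step \<times> (step list \<times> nat list \<times> nat)
    \<Rightarrow> step list \<times> nat list \<times> nat" where
  "join = (\<lambda>(s, c, (mu1, ms1, q1), t, (mu2, ms2, q)). (s # mu1 @ t # mu2, c # ms1 @ c # ms2, q))"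

text \<open>A triple consists of the upper path above \<open>word w\<close>, the numbers of tiles crossing the steps, all
  at least \<open>b\<close>, and the number of boxes above the last vertex, given that there are \<open>p\<close> above the
  first one.\<close>

fun configs :: "dtree \<Rightarrow> nat \<Rightarrow> nat \<Rightarrow> (step list \<times> nat list \<times> nat) set" where
  "configs Leaf b p = {([], [], p)}"
| "configs (Node u v) b p = join `
    (SIGMA s:{s. s = Down \<longrightarrow> 0 < p}. SIGMA c:{b..upper_step s p}. SIGMA x:configs u c (upper_step s p).
      SIGMA t:UNIV. configs v b (lower_step t (snd (snd x))))"

lemma UNIV_step: "(UNIV :: step set) = {Up, Down}"
  using step.exhaust by blast

lemma finite_step: "finite (S :: step set)"
proof -
  have "finite (UNIV :: step set)" unfolding UNIV_step by simp
  then show ?thesis by (rule finite_subset[OF subset_UNIV])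
qed

lemma sum_step: "(\<Sum>s\<in>UNIV. f s) = f Up + f Down"
  unfolding UNIV_step by simp

lemma finite_configs: "finite (configs w b p)"
  by (induction w arbitrary: b p) (auto intro!: finite_imageI finite_SigmaI finite_step)

lemma configs_length: "(mu, ms, q) \<in> configs w b p \<Longrightarrow> length mu = 2 * size w \<and> length ms = 2 * size w"
proof (induction w arbitrary: mu ms q b p)
  case (Node u v)
  then show ?case by (fastforce simp: join_def)
qed simp

lemma configs_NodeE:
  assumes "(mu, ms, q) \<in> configs (Node u v) b p"
  obtains s c mu1 ms1 q1 t mu2 ms2 where "s = Down \<longrightarrow> 0 < p" "b \<le> c" "c \<le> upper_step s p"
    "(mu1, ms1, q1) \<in> configs u c (upper_step s p)" "(mu2, ms2, q) \<in> configs v b (lower_step t q1)"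
    "mu = s # mu1 @ t # mu2" "ms = c # ms1 @ c # ms2"
proof -
  from assms obtain s c x t y where *: "s = Down \<longrightarrow> 0 < p" "c \<in> {b..upper_step s p}"
    "x \<in> configs u c (upper_step s p)" "y \<in> configs v b (lower_step t (snd (snd x)))"
    "(mu, ms, q) = join (s, c, x, t, y)"
    unfolding configs.simps by blast
  obtain mu1 ms1 q1 where x: "x = (mu1, ms1, q1)" using prod_cases3 by blast
  obtain mu2 ms2 q2 where y: "y = (mu2, ms2, q2)" using prod_cases3 by blast
  show thesis
    by (rule that[of s c mu1 ms1 q1 mu2 ms2 t]) (use * in \<open>simp_all add: x y join_def cong: if_cong\<close>)
qed

text \<open>Explains why \<open>configs\<close> compares c only with the number of boxes after the
  up step: at the matching down step c \<le> q1 is automatic, and a down step of the lower path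
  never reduces the number of boxes.\<close>

lemma configs_end_ge: "(mu, ms, q) \<in> configs w b p \<Longrightarrow> b \<le> p \<Longrightarrow> b \<le> q"
proof (induction w arbitrary: mu ms q b p)
  case (Node u v)
  from Node.prems(1) obtain s c mu1 ms1 q1 t mu2 ms2 where c: "b \<le> c" "c \<le> upper_step s p"
    and x: "(mu1, ms1, q1) \<in> configs u c (upper_step s p)"
    and y: "(mu2, ms2, q) \<in> configs v b (lower_step t q1)"
    by (rule configs_NodeE) 
  have "c \<le> q1" using Node.IH(1)[OF x] c by simp
  then show ?case using Node.IH(2)[OF y] c by (auto split: if_splits)
qed simp

text \<open>\<open>word w\<close> returns to height 0, so only the upper path contributes, and a box
  has height 2. The intermediate counts, which \<open>join\<close> forgets, can therefore be
  recovered from the upper path.\<close>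

lemma configs_end: "(mu, ms, q) \<in> configs w b p \<Longrightarrow> 2 * int q = 2 * int p + height mu (length mu)"
proof (induction w arbitrary: mu ms q b p)
  case (Node u v)
  from Node.prems obtain s c mu1 ms1 q1 t mu2 ms2 where s: "s = Down \<longrightarrow> 0 < p"
    and x: "(mu1, ms1, q1) \<in> configs u c (upper_step s p)"
    and y: "(mu2, ms2, q) \<in> configs v b (lower_step t q1)" and mu: "mu = s # mu1 @ t # mu2"
    by (rule configs_NodeE)
  have h: "height mu1 (Suc (length mu1 + l)) = height mu1 (length mu1)" for l
    by (rule height_ge_length) simp
  show ?case using Node.IH(1)[OF x] Node.IH(2)[OF y] s h unfolding mu
    by (cases s; cases t) (auto simp: height_Cons height_append of_nat_diff)
qed simp

lemma inj_on_join:
  "inj_on join (SIGMA s:S. SIGMA c:C s. SIGMA x:configs u c (f s). SIGMA t:T. configs v b (g t (snd (snd x))))"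
proof (rule inj_onI)
  fix x y
  assume x: "x \<in> (SIGMA s:S. SIGMA c:C s. SIGMA x:configs u c (f s). SIGMA t:T. configs v b (g t (snd (snd x))))"
    and y: "y \<in> (SIGMA s:S. SIGMA c:C s. SIGMA x:configs u c (f s). SIGMA t:T. configs v b (g t (snd (snd x))))"
    and eq: "join x = join y"
  obtain s c mu1 ms1 q1 t mu2 ms2 q where xe: "x = (s, c, (mu1, ms1, q1), t, (mu2, ms2, q))"
    by (metis surj_pair)
  obtain s' c' mu1' ms1' q1' t' mu2' ms2' q' where ye: "y = (s', c', (mu1', ms1', q1'), t', (mu2', ms2', q'))"
    by (metis surj_pair)
  have cx: "(mu1, ms1, q1) \<in> configs u c (f s)" and cy: "(mu1', ms1', q1') \<in> configs u c' (f s')"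
    using x y by (auto simp: xe ye)
  have "s = s'" "c = c'" "mu1 = mu1'" "ms1 = ms1'" "t = t'" "mu2 = mu2'" "ms2 = ms2'" "q = q'"
    using eq configs_length[OF cx] configs_length[OF cy] by (auto simp: xe ye join_def)
  moreover from this have "q1 = q1'" using configs_end[OF cx] configs_end[OF cy] by simp
  ultimately show "x = y" by (simp add: xe ye)
qed

definition gain :: "step list \<Rightarrow> step list \<Rightarrow> nat" where
  "gain lam mu = length (filter (\<lambda>(x, y). x = Down \<and> y = Up) (zip lam mu))"

lemma gain_Cons: "gain (x # lam) (y # mu) = (if x = Down \<and> y = Up then 1 else 0) + gain lam mu"
  by (simp add: gain_def)

lemma gain_append: "length lam = length mu \<Longrightarrow> gain (lam @ lam') (mu @ mu') = gain lam mu + gain lam' mu'"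
  by (simp add: gain_def)

text \<open>Identifies \<open>transfer w\<close> as a transfer matrix: F weighs the number of boxes
  at the end, and the coefficient belongs to the number at the start, so vectors travel from right
  to left. Everything stays at least b, so b may be subtracted throughout; this is the
  shift.\<close>

lemma sum_configs:
  "b \<le> p \<Longrightarrow> (\<Sum>(mu, ms, q)\<in>configs w b p. fps_X ^ gain (word w) mu * F $ q) =
     transfer w (fps_shift b F) $ (p - b)"
proof (induction w arbitrary: b p F)
  case Leaf
  then show ?case by (simp add: gain_def)
next
  case (Node u v)
  define D where "D = downstep (transfer v (fps_shift b F))"
  define L where "L = layered (transfer u) D"
  let ?S = "{s. s = Down \<longrightarrow> 0 < p}"
  have inner: "(\<Sum>y\<in>configs v b (lower_step t q1). fps_X ^ gain (Down # word v) (t # fst y) * F $ snd (snd y))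
     = fps_X ^ (if t = Up then 1 else 0) * transfer v (fps_shift b F) $ (lower_step t q1 - b)"
    if "b \<le> q1" for t q1
  proof -
    have "b \<le> lower_step t q1" using that by simp
    from Node.IH(2)[OF this, of F] show ?thesis
      by (auto simp: gain_Cons power_add case_prod_beta sum_distrib_left[symmetric] mult.assoc)
  qed
  have mid: "(\<Sum>t\<in>UNIV. \<Sum>y\<in>configs v b (lower_step t q1).
       fps_X ^ gain (Down # word v) (t # fst y) * F $ snd (snd y)) = D $ (q1 - b)" if "b \<le> q1" for q1
    using that unfolding inner[OF that] sum_step by (simp add: D_def downstep_def Suc_diff_le add.commute)
  \<comment> \<open>\<open>D\<close> is indexed by the excess over b, the induction hypothesis by
    absolute numbers. The factor x^b translates, and no term is lost because the end is at least c
    \<ge> b.\<close>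
  have outer: "(\<Sum>x\<in>configs u c p1. fps_X ^ gain (word u) (fst x) * D $ (snd (snd x) - b)) =
     transfer u (fps_shift (c - b) D) $ (p1 - c)" if "b \<le> c" "c \<le> p1" for c p1
  proof -
    have "fps_shift c (fps_X ^ b * D) = fps_shift (c - b) D"
      using that by (auto simp: fps_eq_iff fps_X_power_mult_nth)
    moreover have "D $ (snd (snd x) - b) = (fps_X ^ b * D) $ snd (snd x)" if "x \<in> configs u c p1" for x
      using configs_end_ge[of "fst x" "fst (snd x)" "snd (snd x)" u c p1] that \<open>b \<le> c\<close> \<open>c \<le> p1\<close>
      by (simp add: fps_X_power_mult_nth)
    ultimately show ?thesis using Node.IH(1)[OF that(2), of "fps_X ^ b * D"]
      by (simp add: case_prod_beta cong: sum.cong)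
  qed
  have "(\<Sum>(mu, ms, q)\<in>configs (Node u v) b p. fps_X ^ gain (word (Node u v)) mu * F $ q) =
    (\<Sum>(s, c, x, t, y)\<in>(SIGMA s:?S. SIGMA c:{b..upper_step s p}. SIGMA x:configs u c (upper_step s p).
      SIGMA t:UNIV. configs v b (lower_step t (snd (snd x)))).
       fps_X ^ gain (word u) (fst x) * (fps_X ^ gain (Down # word v) (t # fst y) * F $ snd (snd y)))"
    unfolding configs.simps
    by (subst sum.reindex[OF inj_on_join], rule sum.cong[OF refl])
      (auto simp: join_def gain_Cons gain_append power_add mult_ac dest!: configs_length)
  also have "\<dots> = (\<Sum>s\<in>?S. \<Sum>c\<in>{b..upper_step s p}. \<Sum>x\<in>configs u c (upper_step s p).
      \<Sum>t\<in>UNIV. \<Sum>y\<in>configs v b (lower_step t (snd (snd x))).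
       fps_X ^ gain (word u) (fst x) * (fps_X ^ gain (Down # word v) (t # fst y) * F $ snd (snd y)))"
    by (simp add: sum.Sigma finite_step finite_configs finite_SigmaI split_def)
  also have "\<dots> = (\<Sum>s\<in>?S. \<Sum>c\<in>{b..upper_step s p}. \<Sum>x\<in>configs u c (upper_step s p).
       fps_X ^ gain (word u) (fst x) * D $ (snd (snd x) - b))"
  proof (intro sum.cong refl)
    fix s c x assume "s \<in> ?S" and c: "c \<in> {b..upper_step s p}" and x: "x \<in> configs u c (upper_step s p)"
    have "b \<le> snd (snd x)"
      using configs_end_ge[of "fst x" "fst (snd x)" "snd (snd x)" u c "upper_step s p"] c x by simp
    from mid[OF this] show "(\<Sum>t\<in>UNIV. \<Sum>y\<in>configs v b (lower_step t (snd (snd x))).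
       fps_X ^ gain (word u) (fst x) * (fps_X ^ gain (Down # word v) (t # fst y) * F $ snd (snd y))) =
       fps_X ^ gain (word u) (fst x) * D $ (snd (snd x) - b)"
      by (simp only: sum_distrib_left[symmetric])
  qed
  also have "\<dots> = (\<Sum>s\<in>?S. \<Sum>c\<in>{b..upper_step s p}. transfer u (fps_shift (c - b) D) $ (upper_step s p - c))"
    by (intro sum.cong refl outer) auto
  \<comment> \<open>The range of c is empty exactly when p = b and the upper path goes down;
    correspondingly, the product of x and L has no constant term.\<close>
  also have "\<dots> = (\<Sum>s\<in>?S. if b \<le> upper_step s p then L $ (upper_step s p - b) else 0)"
  proof (intro sum.cong refl)
    fix s assume "s \<in> ?S"
    have "(\<Sum>c\<in>{b..r}. transfer u (fps_shift (c - b) D) $ (r - c)) = L $ (r - b)" if "b \<le> r" for r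
      unfolding L_def layered_def fps_nth_Abs_fps
      by (rule sum.reindex_bij_witness[where i = "\<lambda>c. c + b" and j = "\<lambda>c. c - b"]) (use that in auto)
    then show "(\<Sum>c\<in>{b..upper_step s p}. transfer u (fps_shift (c - b) D) $ (upper_step s p - c)) =
      (if b \<le> upper_step s p then L $ (upper_step s p - b) else 0)" by simp
  qed
  also have "\<dots> = ((1 + fps_X) * L) $ (p - b)"
  proof (cases "p = 0")
    case True
    then have "?S = {Up}" using step.exhaust by auto
    then show ?thesis using True Node.prems by (simp add: distrib_right)
  next
    case False
    then have "?S = UNIV" by simp
    then show ?thesis using False Node.prems
      by (auto simp: sum_step distrib_right Suc_diff_Suc intro!: arg_cong[of _ _ "fps_nth L"])
  qed
  finally show ?case by (simp add: L_def D_def)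
qed

text \<open>The number of boxes above a vertex of the lower path changes from \<open>p\<close> to \<open>q\<close> along
  a step \<open>l\<close> of the lower and \<open>s\<close> of the upper path.\<close>

definition height_step :: "step \<Rightarrow> step \<Rightarrow> nat \<Rightarrow> nat \<Rightarrow> bool" where
  "height_step l s p q \<longleftrightarrow> (if l = s then q = p else if l = Up then p = Suc q else q = Suc p)"

fun walk :: "step list \<Rightarrow> step list \<Rightarrow> nat list \<Rightarrow> nat \<Rightarrow> nat \<Rightarrow> bool" where
  "walk [] [] [] p q \<longleftrightarrow> p = q"
| "walk (l # lam) (s # mu) (m # ms) p q \<longleftrightarrow>
     (\<exists>r. height_step l s p r \<and> m \<le> p \<and> m \<le> r \<and> walk lam mu ms r q)"
| "walk _ _ _ p q \<longleftrightarrow> False"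

fun nested :: "dtree \<Rightarrow> nat \<Rightarrow> nat list \<Rightarrow> bool" where
  "nested Leaf b ms \<longleftrightarrow> ms = []"
| "nested (Node u v) b ms \<longleftrightarrow>
     (\<exists>c ms1 ms2. ms = c # ms1 @ c # ms2 \<and> b \<le> c \<and> nested u c ms1 \<and> nested v b ms2)"

lemma nested_length: "nested w b ms \<Longrightarrow> length ms = 2 * size w"
  by (induction w b ms rule: nested.induct) auto

lemma walk_append:
  "length ms = length lam \<Longrightarrow> walk (lam @ lam') mu (ms @ ms') p q \<longleftrightarrow>
     (\<exists>mu1 mu2 r. mu = mu1 @ mu2 \<and> walk lam mu1 ms p r \<and> walk lam' mu2 ms' r q)"
proof (induction lam arbitrary: ms mu p)
  case Nil
  have "walk [] mu1 [] p r \<longleftrightarrow> mu1 = [] \<and> r = p" for mu1 r by (cases mu1) auto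
  then show ?case using Nil by auto
next
  case (Cons l lam)
  then obtain m ms1 where ms: "ms = m # ms1" "length ms1 = length lam" by (cases ms) auto
  show ?case
  proof (cases mu)
    case Nil
    then show ?thesis by (simp add: ms)
  next
    case (Cons s mu')
    have "(\<exists>mu1 mu2 r. s # mu' = mu1 @ mu2 \<and> walk (l # lam) mu1 (m # ms1) p r \<and> walk lam' mu2 ms' r q) \<longleftrightarrow>
      (\<exists>mu1 mu2 r. mu' = mu1 @ mu2 \<and> walk (l # lam) (s # mu1) (m # ms1) p r \<and> walk lam' mu2 ms' r q)"
      (is "?A \<longleftrightarrow> ?B")
    proof
      assume ?A
      then obtain mu1 mu2 r where *: "s # mu' = mu1 @ mu2" "walk (l # lam) mu1 (m # ms1) p r" "walk lam' mu2 ms' r q"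
        by blast
      then obtain mu1' where "mu1 = s # mu1'" by (cases mu1) auto
      with * show ?B by auto
    next
      assume ?B
      then show ?A by (metis append_Cons)
    qed
    then show ?thesis using Cons.IH[OF ms(2)] Cons by (auto simp: ms)
  qed
qed

text \<open>Separates the two kinds of conditions: \<open>nested\<close> involves no heights and
  \<open>walk\<close> no chords. They meet only in the crossing numbers of the single steps.\<close>

lemma configs_iff: "(mu, ms, q) \<in> configs w b p \<longleftrightarrow> nested w b ms \<and> walk (word w) mu ms p q"
proof (induction w arbitrary: mu ms q b p)
  case Leaf
  then show ?case by (cases mu) auto
next
  case (Node u v)
  show ?case
  proof
    assume "(mu, ms, q) \<in> configs (Node u v) b p"
    then obtain s c mu1 ms1 q1 t mu2 ms2 where s: "s = Down \<longrightarrow> 0 < p" and c: "b \<le> c" "c \<le> upper_step s p"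
      and x: "(mu1, ms1, q1) \<in> configs u c (upper_step s p)"
      and y: "(mu2, ms2, q) \<in> configs v b (lower_step t q1)"
      and mu: "mu = s # mu1 @ t # mu2" and ms: "ms = c # ms1 @ c # ms2"
      by (rule configs_NodeE)
    have x': "nested u c ms1" "walk (word u) mu1 ms1 (upper_step s p) q1" using x Node.IH(1) by auto
    have y': "nested v b ms2" "walk (word v) mu2 ms2 (lower_step t q1) q" using y Node.IH(2) by auto
    have "c \<le> q1" using configs_end_ge[OF x] c by simp
    then have "walk (Down # word v) (t # mu2) (c # ms2) q1 q"
      using y' by (auto simp: height_step_def intro!: exI[of _ "lower_step t q1"] split: if_splits) (use step.exhaust in blast)+
    then have "walk (word u @ Down # word v) (mu1 @ t # mu2) (ms1 @ c # ms2) (upper_step s p) q"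
      using x' nested_length[OF x'(1)] walk_append[of ms1 "word u"] by fastforce
    moreover have "height_step Up s p (upper_step s p)" using s by (cases s) (auto simp: height_step_def)
    moreover have "c \<le> p" using c by (auto split: if_splits)
    ultimately show "nested (Node u v) b ms \<and> walk (word (Node u v)) mu ms p q"
      using c x' y' by (auto simp: ms mu)
  next
    assume R: "nested (Node u v) b ms \<and> walk (word (Node u v)) mu ms p q"
    then obtain c ms1 ms2 where ms: "ms = c # ms1 @ c # ms2" and c: "b \<le> c"
      and n: "nested u c ms1" "nested v b ms2" by auto
    from R ms obtain s mu' where mu: "mu = s # mu'" by (cases mu) auto
    with R ms obtain p1 where p1: "height_step Up s p p1" "c \<le> p" "c \<le> p1"
      and w: "walk (word u @ Down # word v) mu' (ms1 @ c # ms2) p1 q" by auto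
    from w walk_append[of ms1 "word u"] nested_length[OF n(1)]
    obtain mu1 mu'' q1 where mu': "mu' = mu1 @ mu''" and w1: "walk (word u) mu1 ms1 p1 q1"
      and w2: "walk (Down # word v) mu'' (c # ms2) q1 q" by auto
    from w2 obtain t mu2 where mu'': "mu'' = t # mu2" by (cases mu'') auto
    with w2 obtain p2 where p2: "height_step Down t q1 p2" "walk (word v) mu2 ms2 p2 q" by auto
    have us: "p1 = upper_step s p" "s = Down \<longrightarrow> 0 < p" using p1 by (cases s; auto simp: height_step_def)+
    have ls: "p2 = lower_step t q1" using p2 by (cases t) (auto simp: height_step_def)
    have "(mu1, ms1, q1) \<in> configs u c (upper_step s p)" using Node.IH(1) n w1 us by simp
    moreover have "(mu2, ms2, q) \<in> configs v b (lower_step t q1)" using Node.IH(2) n p2 ls by simp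
    moreover have "(mu, ms, q) = join (s, c, (mu1, ms1, q1), t, (mu2, ms2, q))"
      by (simp add: join_def mu mu' mu'' ms)
    moreover have "c \<in> {b..upper_step s p}" using c p1 us by simp
    ultimately show "(mu, ms, q) \<in> configs (Node u v) b p"
      unfolding configs.simps using us(2)
      by (intro image_eqI[of _ _ "(s, c, (mu1, ms1, q1), t, (mu2, ms2, q))"]) (simp_all cong: if_cong)
  qed
qed

text \<open>Twice the number of boxes above vertex i is 2 p plus the difference of the heights. Its
  increments are even, so nonnegativity is all that the intermediate counts of \<open>walk\<close>
  require.\<close>

lemma walk_iff:
  assumes "length mu = length lam" "length ms = length lam"
  shows "walk lam mu ms p q \<longleftrightarrow>
    (\<forall>i\<le>length lam. 0 \<le> 2 * int p + height mu i - height lam i) \<and>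
    2 * int p + height mu (length lam) - height lam (length lam) = 2 * int q \<and>
    (\<forall>i<length lam. 2 * int (ms ! i) \<le> 2 * int p + height mu i - height lam i \<and>
       2 * int (ms ! i) \<le> 2 * int p + height mu (Suc i) - height lam (Suc i))"
  using assms
proof (induction lam arbitrary: mu ms p)
  case Nil
  then show ?case by auto
next
  case (Cons l lam)
  obtain s mu' where mu: "mu = s # mu'" "length mu' = length lam" using Cons.prems by (cases mu) auto
  obtain m ms' where ms: "ms = m # ms'" "length ms' = length lam" using Cons.prems by (cases ms) auto
  define H where "H p i = 2 * int p + height mu' i - height lam i" for p i
  define \<delta> where "\<delta> = (case s of Up \<Rightarrow> (1 :: int) | Down \<Rightarrow> - 1) - (case l of Up \<Rightarrow> 1 | Down \<Rightarrow> - 1)"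
  have step: "height_step l s p r \<longleftrightarrow> 2 * int r = 2 * int p + \<delta>" for r
    by (cases l; cases s) (auto simp: height_step_def \<delta>_def)
  have ev: "even \<delta>" by (cases l; cases s) (auto simp: \<delta>_def)
  have Suc: "2 * int p + height mu (Suc i) - height (l # lam) (Suc i) = 2 * int p + \<delta> + height mu' i - height lam i" for i
    by (simp add: mu height_Cons \<delta>_def)
  show ?case
  proof (cases "2 * int p + \<delta> \<ge> 0")
    case False
    then have "\<not> walk (l # lam) mu ms p q" by (auto simp: mu ms step)
    moreover have "\<not> 0 \<le> 2 * int p + height mu (Suc 0) - height (l # lam) (Suc 0)"
      using False unfolding Suc by simp
    ultimately show ?thesis by (metis Suc_le_mono le0 length_Cons)
  next
    case True
    define r where "r = nat ((2 * int p + \<delta>) div 2)"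
    have r: "2 * int p + \<delta> = 2 * int r" using True ev by (auto simp: r_def elim!: evenE)
    have "walk (l # lam) mu ms p q \<longleftrightarrow> m \<le> p \<and> m \<le> r \<and> walk lam mu' ms' r q"
      unfolding mu ms walk.simps step r by auto
    also have "walk lam mu' ms' r q \<longleftrightarrow> (\<forall>i\<le>length lam. 0 \<le> H r i) \<and> H r (length lam) = 2 * int q \<and>
       (\<forall>i<length lam. 2 * int (ms' ! i) \<le> H r i \<and> 2 * int (ms' ! i) \<le> H r (Suc i))"
      unfolding H_def by (rule Cons.IH[OF mu(2) ms(2)])
    finally have W: "walk (l # lam) mu ms p q \<longleftrightarrow> m \<le> p \<and> m \<le> r \<and> (\<forall>i\<le>length lam. 0 \<le> H r i) \<and>
       H r (length lam) = 2 * int q \<and>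
       (\<forall>i<length lam. 2 * int (ms' ! i) \<le> H r i \<and> 2 * int (ms' ! i) \<le> H r (Suc i))" .
    have S: "2 * int p + height mu (Suc i) - height (l # lam) (Suc i) = H r i" for i
      unfolding Suc r H_def ..
    have H0: "H r 0 = 2 * int r" by (simp add: H_def)
    show ?thesis unfolding W length_Cons All_less_Suc2 less_Suc_eq_le[symmetric] S
      by (auto simp: ms H0 less_Suc_eq_le)
  qed
qed

text \<open>Turns the recursion over the tree into conditions on single chords. The lists around
  \<open>ms\<close> let both subtrees use positions in one common list.\<close>

lemma nested_iff:
  assumes "length ms = 2 * size w"
  defines "L \<equiv> \<lambda>a z r. (a @ ms @ z) ! (r - 1)"
  shows "nested w b ms \<longleftrightarrow>
    (\<forall>r. length a < r \<and> r \<le> length a + 2 * size w \<longrightarrow> b \<le> L a z r) \<and>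
    (\<forall>(i, j)\<in>tree_chords w (length a). L a z i = L a z j \<and> (\<forall>r\<in>{i..j}. L a z i \<le> L a z r))"
  using assms(1) unfolding L_def
proof (induction w arbitrary: ms a z b)
  case Leaf
  then show ?case by auto
next
  case (Node u v)
  obtain c xs where xs: "ms = c # xs" "length xs = 2 * size u + Suc (2 * size v)"
    using Node.prems by (cases ms) auto
  define ms1 d ms2 where "ms1 = take (2 * size u) xs" and "d = xs ! (2 * size u)"
    and "ms2 = drop (Suc (2 * size u)) xs"
  then have ms: "ms = c # ms1 @ d # ms2" and l1: "length ms1 = 2 * size u" and l2: "length ms2 = 2 * size v"
    using xs id_take_nth_drop[of "2 * size u" xs] by simp_all
  define K where "K = (\<lambda>r. (a @ ms @ z) ! (r - 1))"
  have K1: "((a @ [c]) @ ms1 @ (d # ms2 @ z)) ! (r - 1) = K r" for r by (simp add: K_def ms)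
  have K2: "((a @ c # ms1 @ [d]) @ ms2 @ z) ! (r - 1) = K r" for r by (simp add: K_def ms)
  have Kc: "K (Suc (length a)) = c" by (simp add: K_def ms nth_append)
  have Kd: "K (length a + 2 + 2 * size u) = d" by (simp add: K_def ms nth_append l1)
  note I1 = Node.IH(1)[OF l1, of _ "a @ [c]" "d # ms2 @ z", unfolded K1]
  note I2 = Node.IH(2)[OF l2, of _ "a @ c # ms1 @ [d]" z, unfolded K2]
  define la U V where "la = length a" and "U r \<longleftrightarrow> Suc la < r \<and> r \<le> Suc la + 2 * size u"
    and "V r \<longleftrightarrow> la + 2 + 2 * size u < r \<and> r \<le> la + 2 + 2 * size u + 2 * size v" for r
  define good where "good C \<longleftrightarrow> (\<forall>(i, j)\<in>C. K i = K j \<and> (\<forall>r\<in>{i..j}. K i \<le> K r))" for C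
  have "nested (Node u v) b ms \<longleftrightarrow> c = d \<and> b \<le> c \<and> nested u c ms1 \<and> nested v b ms2"
  proof
    assume "nested (Node u v) b ms"
    then obtain c' ms1' ms2' where *: "ms = c' # ms1' @ c' # ms2'" "b \<le> c'" "nested u c' ms1'" "nested v b ms2'"
      by auto
    then have "ms1' = ms1" "c' = c" "c' = d" "ms2' = ms2"
      using ms l1 nested_length[OF *(3)] by auto
    with * show "c = d \<and> b \<le> c \<and> nested u c ms1 \<and> nested v b ms2" by simp
  qed (auto simp: ms)
  also have "nested u c ms1 \<longleftrightarrow> (\<forall>r. U r \<longrightarrow> c \<le> K r) \<and> good (tree_chords u (Suc la))"
    using I1[of c] by (simp add: U_def la_def good_def)
  also have "nested v b ms2 \<longleftrightarrow> (\<forall>r. V r \<longrightarrow> b \<le> K r) \<and> good (tree_chords v (la + 2 + 2 * size u))"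
    using I2[of b] by (simp add: V_def la_def good_def l1)
  also have "c = d \<and> b \<le> c \<and> ((\<forall>r. U r \<longrightarrow> c \<le> K r) \<and> good (tree_chords u (Suc la))) \<and>
      ((\<forall>r. V r \<longrightarrow> b \<le> K r) \<and> good (tree_chords v (la + 2 + 2 * size u))) \<longleftrightarrow>
    (\<forall>r. r = Suc la \<or> U r \<or> r = la + 2 + 2 * size u \<or> V r \<longrightarrow> b \<le> K r) \<and>
    (c = d \<and> (\<forall>r. r = Suc la \<or> U r \<or> r = la + 2 + 2 * size u \<longrightarrow> c \<le> K r)) \<and>
    good (tree_chords u (Suc la)) \<and> good (tree_chords v (la + 2 + 2 * size u))" (is "?L \<longleftrightarrow> ?R")
  proof
    assume L: ?L
    have "b \<le> K r" if "r = Suc la \<or> U r \<or> r = la + 2 + 2 * size u \<or> V r" for r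
      using that L Kc Kd unfolding la_def[symmetric] by auto
    moreover have "c \<le> K r" if "r = Suc la \<or> U r \<or> r = la + 2 + 2 * size u" for r
      using that L Kc Kd unfolding la_def[symmetric] by auto
    ultimately show ?R using L by blast
  next
    assume R: ?R
    then have "b \<le> K (Suc la)" by blast
    then have "b \<le> c" using Kc unfolding la_def[symmetric] by simp
    then show ?L using R by blast
  qed
  also have "\<dots> \<longleftrightarrow> (\<forall>r. la < r \<and> r \<le> la + 2 * size (Node u v) \<longrightarrow> b \<le> K r) \<and>
    (c = d \<and> (\<forall>r\<in>{Suc la..la + 2 + 2 * size u}. c \<le> K r)) \<and>
    good (tree_chords u (Suc la)) \<and> good (tree_chords v (la + 2 + 2 * size u))"
  proof -
    have "r = Suc la \<or> U r \<or> r = la + 2 + 2 * size u \<longleftrightarrow> r \<in> {Suc la..la + 2 + 2 * size u}" for r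
      by (auto simp: U_def)
    moreover have "r = Suc la \<or> U r \<or> r = la + 2 + 2 * size u \<or> V r \<longleftrightarrow> la < r \<and> r \<le> la + 2 * size (Node u v)" for r
      by (auto simp: U_def V_def)
    ultimately show ?thesis by (simp only: Ball_def)
  qed
  also have "\<dots> \<longleftrightarrow> (\<forall>r. la < r \<and> r \<le> la + 2 * size (Node u v) \<longrightarrow> b \<le> K r) \<and> good (tree_chords (Node u v) la)"
    using Kc Kd unfolding la_def[symmetric] by (simp add: good_def ball_Un)
  finally show ?case unfolding K_def good_def la_def .
qed

section \<open>The shape of cover-inclusive tilings\<close>

lemma height_Suc: "i < length p \<Longrightarrow> height p (Suc i) = height p i + (case p ! i of Up \<Rightarrow> 1 | Down \<Rightarrow> - 1)"
  by (simp add: height_def take_Suc_conv_app_nth)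

lemma height_Suc_abs: "i < length p \<Longrightarrow> \<bar>height p (Suc i) - height p i\<bar> = 1"
  by (simp add: height_Suc split: step.split)

lemma height_parity: "i \<le> length p \<Longrightarrow> even (height p i + int i)"
proof (induction i)
  case (Suc i)
  then show ?case by (auto simp: height_Suc split: step.split)
qed simp

definition list_fun :: "nat list \<Rightarrow> nat \<Rightarrow> nat" where
  "list_fun ms r = ms ! (r - 1)"

locale tree_and_upper_path =
  fixes w :: dtree and mu :: "step list"
  assumes mu: "dyck_path (size w) mu" and above: "weakly_above (size w) mu (word w)"
begin

abbreviation "lam \<equiv> word w"
abbreviation "n \<equiv> size w"

definition g :: "nat \<Rightarrow> int" where "g = height lam"

text \<open>As a box has height 2, this is the number of boxes in the column of vertex i.\<close>

definition layers :: "nat \<Rightarrow> nat" where "layers i = nat ((height mu i - g i) div 2)"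

lemma length_mu: "length mu = 2 * n"
  using mu by (simp add: dyck_path_def)

lemma layers: "i \<le> 2 * n \<Longrightarrow> height mu i = g i + 2 * int (layers i)"
proof -
  assume i: "i \<le> 2 * n"
  have "even ((height mu i + int i) - (g i + int i))"
    using i height_parity[of i mu] height_parity[of i lam] by (simp add: length_mu g_def)
  moreover have "0 \<le> height mu i - g i" using above i by (simp add: weakly_above_def g_def)
  ultimately show ?thesis by (auto simp: layers_def elim!: evenE)
qed

lemma layers_ends: "layers 0 = 0" "layers (2 * n) = 0"
  using mu by (simp_all add: layers_def g_def dyck_path_def)

lemma g_adjacent: "i < 2 * n \<Longrightarrow> \<bar>g (Suc i) - g i\<bar> = 1"
  using height_Suc_abs[of i lam] by (simp add: g_def)

text \<open>Coordinates relative to the lower path: for fixed k, the layer, the boxes trace a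
  vertical translate of that path.\<close>

definition box :: "nat \<Rightarrow> nat \<Rightarrow> box" where
  "box i k = (int i - int n, g i + 2 * int k)"

lemma box_inject [simp]: "box i k = box j l \<longleftrightarrow> i = j \<and> k = l"
  by (auto simp: box_def)

lemma skew_shape_boxes: "skew_shape n lam mu = {box i k |i k. i \<le> 2 * n \<and> k < layers i}"
proof (intro set_eqI iffI)
  fix b assume b: "b \<in> skew_shape n lam mu"
  obtain x y where xy: "b = (x, y)" by force
  have *: "even (x + y + int n)" "- int n \<le> x" "x \<le> int n" "ordinate n lam x \<le> y" "y + 2 \<le> ordinate n mu x"
    using b by (auto simp: xy skew_shape_def box_vertices_def)
  define i where "i = nat (x + int n)"
  have i: "i \<le> 2 * n" "x = int i - int n" using * by (auto simp: i_def)
  have y: "g i \<le> y" "y + 2 \<le> height mu i" using * by (auto simp: ordinate_def i_def g_def)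
  have "even ((x + y + int n) - (g i + int i))"
    using *(1) height_parity[of i lam] i by (simp add: g_def)
  then have "even (y - g i)" by (simp add: i(2))
  then have k: "y = g i + 2 * int (nat ((y - g i) div 2))" using y by (auto elim!: evenE)
  moreover have "nat ((y - g i) div 2) < layers i" using y layers[OF i(1)] by linarith
  moreover from calculation(1) have "b = box i (nat ((y - g i) div 2))" using i(2) xy by (simp only: box_def)
  ultimately show "b \<in> {box i k |i k. i \<le> 2 * n \<and> k < layers i}" using i(1) by blast
next
  fix b assume "b \<in> {box i k |i k. i \<le> 2 * n \<and> k < layers i}"
  then obtain i k where b: "b = box i k" and i: "i \<le> 2 * n" and k: "k < layers i" by auto
  \<comment> \<open>The two paths meet at both ends, so the column is interior and has neighbours on
    both sides; there the slopes \<plusminus>1 give the bounds for the side vertices.\<close>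
  have "i \<noteq> 0" "i \<noteq> 2 * n" using k layers_ends by (metis not_less_zero)+
  then obtain j where j: "i = Suc j" and lt: "i < 2 * n" using i by (cases i) auto
  have "even (g i + int i)" using height_parity[of i lam] i by (simp add: g_def)
  moreover have "\<bar>height mu (Suc i) - height mu i\<bar> = 1" "\<bar>height mu (Suc j) - height mu j\<bar> = 1"
    using lt j by (auto intro!: height_Suc_abs simp: length_mu)
  moreover have "\<bar>g (Suc i) - g i\<bar> = 1" "\<bar>g (Suc j) - g j\<bar> = 1" using lt j by (auto intro!: g_adjacent)
  moreover have "nat (1 + int i) = Suc i" "nat (int i) = i" "nat (int i - 1) = j" using j by auto
  ultimately show "b \<in> skew_shape n lam mu"
    using layers[OF i] k lt j unfolding g_def
    by (auto simp: b box_def skew_shape_def box_vertices_def ordinate_def g_def algebra_simps)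
qed

lemma box_in_skew: "box i k \<in> skew_shape n lam mu \<longleftrightarrow> i \<le> 2 * n \<and> k < layers i"
  by (auto simp: skew_shape_boxes)

definition segment :: "nat \<Rightarrow> nat \<Rightarrow> nat \<Rightarrow> box set" where
  "segment a b k = (\<lambda>j. box j k) ` {a..b}"

text \<open>The Dyck subpaths of the lower path, given by their end vertices; a = b is allowed and
  corresponds to a tile with a single box.\<close>

definition level_segment :: "nat \<Rightarrow> nat \<Rightarrow> bool" where
  "level_segment a b \<longleftrightarrow> a \<le> b \<and> b \<le> 2 * n \<and> g a = g b \<and> (\<forall>j\<in>{a..b}. g a \<le> g j)"

lemma level_segmentD: "level_segment a b \<Longrightarrow> a \<le> j \<Longrightarrow> j \<le> b \<Longrightarrow> g a \<le> g j \<and> g b \<le> g j"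
  by (auto simp: level_segment_def)

lemma box_in_segment [simp]: "box j l \<in> segment a b k \<longleftrightarrow> a \<le> j \<and> j \<le> b \<and> l = k"
  by (auto simp: segment_def)

lemma dyck_tile_segment:
  assumes "level_segment a b" shows "dyck_tile (segment a b k)"
  unfolding dyck_tile_def
proof (intro exI conjI)
  define f where "f x = g (nat (x + int n)) + 2 * int k" for x
  have f: "f (int j - int n) = g j + 2 * int k" for j by (simp add: f_def)
  have ex: "\<exists>j. x = int j - int n \<and> a \<le> j \<and> j \<le> b" if "int a - int n \<le> x" "x \<le> int b - int n" for x
    by (rule exI[of _ "nat (x + int n)"]) (use that in auto)
  show "int a - int n \<le> int b - int n" using assms by (simp add: level_segment_def)
  show "segment a b k = {(x, f x) |x. int a - int n \<le> x \<and> x \<le> int b - int n}"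
    using ex f by (fastforce simp: segment_def box_def image_def)
  show "\<forall>x. int a - int n \<le> x \<and> x < int b - int n \<longrightarrow> \<bar>f (x + 1) - f x\<bar> = 1"
  proof (intro allI impI)
    fix x assume x: "int a - int n \<le> x \<and> x < int b - int n"
    then obtain j where j: "x = int j - int n" using ex[of x] by auto
    have "x + 1 = int (Suc j) - int n" by (simp add: j)
    then have "f (x + 1) = g (Suc j) + 2 * int k" by (simp only: f)
    moreover have "f x = g j + 2 * int k" by (simp only: j f)
    moreover have "j < 2 * n" using x j assms by (auto simp: level_segment_def)
    ultimately show "\<bar>f (x + 1) - f x\<bar> = 1" using g_adjacent[of j] by simp
  qed
  show "f (int a - int n) = f (int b - int n)" using assms by (simp add: f level_segment_def)
  show "\<forall>x. int a - int n \<le> x \<and> x \<le> int b - int n \<longrightarrow> f (int a - int n) \<le> f x"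
    using ex assms f by (fastforce simp: level_segment_def)
qed

section \<open>From crossing numbers to tilings\<close>

definition linked :: "(nat \<Rightarrow> nat) \<Rightarrow> nat \<Rightarrow> nat \<Rightarrow> nat \<Rightarrow> bool" where
  "linked M k i j \<longleftrightarrow> (\<forall>r. min i j < r \<and> r \<le> max i j \<longrightarrow> k < M r)"

text \<open>\<open>M r\<close> acts as a threshold: step r is crossed in the layers k <
  \<open>M r\<close> and in no others. The tiles of a layer are the classes of
  \<open>linked\<close>.\<close>

definition tile :: "(nat \<Rightarrow> nat) \<Rightarrow> nat \<Rightarrow> nat \<Rightarrow> box set" where
  "tile M i k = (\<lambda>j. box j k) ` {j. j \<le> 2 * n \<and> linked M k i j}"

definition tiles :: "(nat \<Rightarrow> nat) \<Rightarrow> box set set" where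
  "tiles M = {tile M i k |i k. i \<le> 2 * n \<and> k < layers i}"

text \<open>The bounds ensure that boxes joined across a step lie in the shape; the chord conditions
  make the joined runs Dyck paths.\<close>

definition valid :: "(nat \<Rightarrow> nat) \<Rightarrow> bool" where
  "valid M \<longleftrightarrow> (\<forall>i<2 * n. M (Suc i) \<le> layers i \<and> M (Suc i) \<le> layers (Suc i)) \<and>
     (\<forall>(s, t)\<in>tree_chords w 0. M s = M t \<and> (\<forall>r\<in>{s..t}. M s \<le> M r))"

lemma box_in_tile [simp]: "box j l \<in> tile M i k \<longleftrightarrow> l = k \<and> j \<le> 2 * n \<and> linked M k i j"
  by (auto simp: tile_def)

lemma linked_refl: "linked M k i i"
  by (simp add: linked_def)

lemma linked_sym: "linked M k i j \<Longrightarrow> linked M k j i"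
  by (simp add: linked_def min.commute max.commute)

lemma linked_trans:
  assumes "linked M k i j" "linked M k j l" shows "linked M k i l"
  unfolding linked_def
proof (intro allI impI)
  fix r assume r: "min i l < r \<and> r \<le> max i l"
  have "min i j < r \<and> r \<le> max i j \<or> min j l < r \<and> r \<le> max j l" using r by linarith
  then show "k < M r" using assms unfolding linked_def by blast
qed

lemma linked_between: "linked M k i l \<Longrightarrow> i \<le> j \<Longrightarrow> j \<le> l \<Longrightarrow> linked M k i j"
  by (auto simp: linked_def)

lemma linked_layers:
  assumes "valid M" "linked M k i j" "k < layers i" "i \<le> 2 * n" "j \<le> 2 * n"
  shows "k < layers j"
proof (cases i j rule: linorder_cases)
  case less
  then have "k < M (Suc (j - 1))" using assms by (simp add: linked_def)
  also have "\<dots> \<le> layers (Suc (j - 1))" using assms less unfolding valid_def by (simp del: Suc_pred)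
  finally show ?thesis using less by simp
next
  case greater
  then have "k < M (Suc j)" using assms by (simp add: linked_def)
  also have "\<dots> \<le> layers j" using assms greater unfolding valid_def by simp
  finally show ?thesis .
qed (use assms in simp)

lemma tile_eq: "linked M k i j \<Longrightarrow> tile M i k = tile M j k"
  using linked_trans linked_sym unfolding tile_def by blast

lemma chord_at:
  assumes "j < 2 * n"
  obtains s t where "(s, t) \<in> tree_chords w 0" "Suc j = s \<or> Suc j = t"
  using tree_chords_complete[of "[]" "Suc j" w] assms by auto

lemma chord_props:
  assumes "(s, t) \<in> tree_chords w 0"
  shows "1 \<le> s" "s < t" "t \<le> 2 * n" "g t = g (s - 1)" "\<And>r. s \<le> r \<Longrightarrow> r < t \<Longrightarrow> g (s - 1) < g r"
    "g s = g (s - 1) + 1" "g (t - 1) = g t + 1"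
proof -
  have c: "is_chord lam s t" using tree_chords_sound[of s t w "[]" "[]"] assms by simp
  then show "1 \<le> s" "s < t" "t \<le> 2 * n" "g t = g (s - 1)" "\<And>r. s \<le> r \<Longrightarrow> r < t \<Longrightarrow> g (s - 1) < g r"
    by (auto simp: is_chord_def g_def)
  have "Suc (s - 1) = s" "Suc (t - 1) = t" "s - 1 < length lam" "t - 1 < length lam"
    using c by (auto simp: is_chord_def)
  then show "g s = g (s - 1) + 1" "g (t - 1) = g t + 1"
    using height_Suc[of "s - 1" lam] height_Suc[of "t - 1" lam] c
    by (auto simp: is_chord_def step_at_def g_def)
qed

text \<open>A maximal linked run consists of whole chords: crossing one of the two steps of a chord
  forces crossing everything between them, since the chord has the least crossing number there. A
  piece of the path that cuts no chord has its lowest points at both ends.\<close>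

lemma tile_segment:
  assumes "valid M" "i \<le> 2 * n"
  obtains a b where "level_segment a b" "tile M i k = segment a b k"
proof -
  define S where "S = {j. j \<le> 2 * n \<and> linked M k i j}"
  have fin: "finite S" and i: "i \<in> S" using assms by (auto simp: S_def linked_refl)
  define a b where "a = Min S" and "b = Max S"
  have aS: "a \<in> S" and bS: "b \<in> S" and bd: "\<And>j. j \<in> S \<Longrightarrow> a \<le> j \<and> j \<le> b"
    using Min_in[OF fin] Max_in[OF fin] Min_le[OF fin] Max_ge[OF fin] i by (auto simp: a_def b_def)
  have "linked M k a i" "linked M k i b" using aS bS by (simp_all add: S_def linked_sym)
  then have ab: "linked M k a b" by (rule linked_trans)
  have S_iff: "j \<in> S \<longleftrightarrow> a \<le> j \<and> j \<le> b" for j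
  proof
    assume "a \<le> j \<and> j \<le> b"
    then have "linked M k a j" "j \<le> 2 * n" using linked_between[OF ab] bS by (auto simp: S_def)
    then show "j \<in> S" using aS linked_trans[of M k i a j] by (simp add: S_def)
  qed (use bd in blast)
  have S_step: "j \<in> S" if "j' \<in> S" "linked M k j' j" "j \<le> 2 * n" for j j'
    using that linked_trans[of M k i j' j] by (simp add: S_def)
  have chord_in: "a \<le> s - 1 \<and> t \<le> b" if st: "(s, t) \<in> tree_chords w 0" and "a < r" "r \<le> b" "r = s \<or> r = t" for s t r
  proof -
    have "k < M r" using ab that(2,3) by (auto simp: linked_def)
    moreover have M: "M s = M t \<and> (\<forall>r\<in>{s..t}. M s \<le> M r)" using assms(1) st unfolding valid_def by blast
    ultimately have "k < M s" using \<open>r = s \<or> r = t\<close> by auto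
    then have "k < M r'" if "r' \<in> {s..t}" for r' using M that by (blast intro: less_le_trans)
    then have l: "linked M k (s - 1) t" using chord_props[OF st] by (auto simp: linked_def)
    have r: "s - 1 \<le> r" "r \<le> t" using that chord_props(2)[OF st] by auto
    have "r \<in> S" using that by (simp add: S_iff)
    moreover have "linked M k r (s - 1)" using linked_between[OF l r] linked_sym by blast
    ultimately have "s - 1 \<in> S" using S_step chord_props[OF st] by (metis diff_le_self le_trans less_imp_le_nat)
    moreover from this have "t \<in> S" using S_step[OF _ l] chord_props[OF st] by simp
    ultimately show ?thesis by (simp add: S_iff)
  qed
  have b: "b \<le> 2 * n" using bS by (simp add: S_def)
  \<comment> \<open>The induction jumps from j to the left end s - 1 of the chord through the step
    ending at j; that vertex is not higher.\<close>
  have ge_a: "a \<le> j \<Longrightarrow> j \<le> b \<Longrightarrow> g a \<le> g j" for j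
  proof (induction j rule: less_induct)
    case (less j)
    show ?case
    proof (cases "j = a")
      case False
      then have j: "j - 1 < 2 * n" "Suc (j - 1) = j" using less b by auto
      obtain s t where st: "(s, t) \<in> tree_chords w 0" "j = s \<or> j = t"
        using chord_at[OF j(1)] unfolding j(2) by blast
      have "a \<le> s - 1" "s - 1 < j"
        using chord_in[OF st(1), of j] chord_props[OF st(1)] st(2) less False by auto
      then have "g a \<le> g (s - 1)" using less by simp
      also have "g (s - 1) \<le> g j" using st(2) chord_props(4,6)[OF st(1)] by auto
      finally show ?thesis .
    qed simp
  qed
  \<comment> \<open>Mirror image, by induction on the distance d from b: the jump goes to the right
    end t of the chord through the step starting at b - d.\<close>
  have ge_b: "a \<le> b - d \<Longrightarrow> d \<le> b \<Longrightarrow> g b \<le> g (b - d)" for d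
  proof (induction d rule: less_induct)
    case (less d)
    show ?case
    proof (cases "d = 0")
      case False
      define j where "j = b - d"
      have jb: "j < b" "a \<le> j" "d = b - j" using False less by (auto simp: j_def)
      obtain s t where st: "(s, t) \<in> tree_chords w 0" "Suc j = s \<or> Suc j = t"
        using chord_at[OF less_le_trans[OF jb(1) b]] by blast
      have t: "t \<le> b" "j < t"
        using chord_in[OF st(1), of "Suc j"] chord_props[OF st(1)] st(2) jb by auto
      have "b - t < d" "b - (b - t) = t" using t jb less.prems by auto
      then have "g b \<le> g t" using less.IH[of "b - t"] t jb by simp
      also have "g t \<le> g j" using st(2) chord_props(4,7)[OF st(1)] by auto
      finally show ?thesis by (simp add: j_def)
    qed simp
  qed
  have "a \<le> b" using bd[OF i] by simp
  moreover from this have "g a = g b" using ge_a[of b] ge_b[of "b - a"] by simp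
  ultimately have "level_segment a b" using ge_a b by (simp add: level_segment_def)
  moreover have "tile M i k = segment a b k"
  proof -
    have "S = {a..b}" by (rule set_eqI) (simp add: S_iff)
    then show ?thesis unfolding tile_def segment_def S_def by (rule arg_cong)
  qed
  ultimately show thesis by (rule that)
qed

lemma column_box: "(int j - int n, y) = box i k \<Longrightarrow> i = j \<and> y = g j + 2 * int k"
  by (auto simp: box_def)

lemma covers_boxes: "box i k' \<in> A \<Longrightarrow> box i k \<in> B \<Longrightarrow> k < k' \<Longrightarrow> covers A B"
  unfolding covers_def box_def by (intro exI conjI, assumption, assumption, simp)

lemma tiles_tiling:
  assumes M: "valid M"
  shows "dyck_tiling n lam mu (tiles M)" "cover_inclusive (tiles M)"
proof -
  have sub: "tile M i k \<subseteq> skew_shape n lam mu" if "i \<le> 2 * n" "k < layers i" for i k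
    using that linked_layers[OF M] by (auto simp: tile_def box_in_skew)
  have "partition_on (skew_shape n lam mu) (tiles M)"
  proof (rule partition_onI)
    show "\<Union> (tiles M) = skew_shape n lam mu"
    proof
      show "\<Union> (tiles M) \<subseteq> skew_shape n lam mu" using sub by (auto simp: tiles_def)
      show "skew_shape n lam mu \<subseteq> \<Union> (tiles M)"
      proof
        fix x assume "x \<in> skew_shape n lam mu"
        then obtain i k where "x = box i k" "i \<le> 2 * n" "k < layers i" by (auto simp: skew_shape_boxes)
        moreover from this have "x \<in> tile M i k" by (simp add: linked_refl)
        moreover have "tile M i k \<in> tiles M" using calculation unfolding tiles_def by blast
        ultimately show "x \<in> \<Union> (tiles M)" by blast
      qed
    qed
    show "disjnt p q" if "p \<in> tiles M" "q \<in> tiles M" "p \<noteq> q" for p q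
    proof (rule ccontr)
      assume "\<not> disjnt p q"
      from that obtain i k i' k' where pq: "p = tile M i k" "q = tile M i' k'" by (auto simp: tiles_def)
      with \<open>\<not> disjnt p q\<close> obtain j where "k = k'" "linked M k i j" "linked M k i' j"
        by (auto simp: disjnt_def tile_def)
      then have "p = q" using pq tile_eq by metis
      then show False using that by simp
    qed
    show "{} \<notin> tiles M"
    proof
      assume "{} \<in> tiles M"
      then obtain i k where e: "{} = tile M i k" and i: "i \<le> 2 * n" by (auto simp: tiles_def)
      from i have "box i k \<in> tile M i k" by (simp add: linked_refl)
      then show False using e by blast
    qed
  qed
  moreover have "dyck_tile A" if "A \<in> tiles M" for A
  proof -
    from that obtain i k where "A = tile M i k" "i \<le> 2 * n" by (auto simp: tiles_def)
    then show ?thesis using tile_segment[OF M, of i k] dyck_tile_segment by metis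
  qed
  ultimately show "dyck_tiling n lam mu (tiles M)" by (simp add: dyck_tiling_def)
  show "cover_inclusive (tiles M)"
    unfolding cover_inclusive_def
  proof (intro ballI impI)
    fix A B assume "A \<in> tiles M" "B \<in> tiles M" and cov: "covers A B"
    then obtain i k i' k' where AB: "A = tile M i k" "B = tile M i' k'" by (auto simp: tiles_def)
    from cov obtain j where j: "linked M k i j" "linked M k' i' j" "k' < k"
      by (auto simp: covers_def AB tile_def box_def)
    \<comment> \<open>The condition k < \<open>M r\<close> weakens as k decreases, so runs in a
      lower layer contain the runs above them.\<close>
    have "linked M k' i' l" if "linked M k i l" for l
    proof -
      have "linked M k j l" using linked_trans[OF linked_sym[OF j(1)] that] .
      then have "linked M k' j l" using j(3) by (auto simp: linked_def)
      then show ?thesis using linked_trans[OF j(2)] by blast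
    qed
    then show "columns A \<subseteq> columns B" by (auto simp: AB columns_def tile_def image_image box_def)
  qed
qed

definition joined :: "box set set \<Rightarrow> nat \<Rightarrow> nat \<Rightarrow> bool" where
  "joined T j k \<longleftrightarrow> (\<exists>A\<in>T. box j k \<in> A \<and> box (Suc j) k \<in> A)"

text \<open>Recovers M from its tiling, which is the injectivity of the encoding.\<close>

lemma joined_tiles:
  assumes "valid M" "j < 2 * n"
  shows "joined (tiles M) j k \<longleftrightarrow> k < M (Suc j)"
proof
  assume "joined (tiles M) j k"
  then obtain i where "linked M k i j" "linked M k i (Suc j)" by (auto simp: joined_def tiles_def)
  then have "linked M k j (Suc j)" using linked_sym linked_trans by blast
  then show "k < M (Suc j)" by (simp add: linked_def)
next
  assume k: "k < M (Suc j)"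
  then have "linked M k j (Suc j)" by (auto simp: linked_def le_Suc_eq)
  moreover have "k < layers j" using k assms by (auto simp: valid_def intro: less_le_trans)
  moreover from this have "tile M j k \<in> tiles M"
    unfolding tiles_def using assms(2) by (intro CollectI exI[of _ j] exI[of _ k]) simp
  ultimately show "joined (tiles M) j k" using assms(2) linked_refl
    by (auto simp: joined_def intro!: bexI[of _ "tile M j k"])
qed

section \<open>From cover-inclusive tilings to crossing numbers\<close>

context
  fixes T assumes tiling: "dyck_tiling n lam mu T" and incl: "cover_inclusive T"
begin

lemma tile_unique: "A \<in> T \<Longrightarrow> B \<in> T \<Longrightarrow> x \<in> A \<Longrightarrow> x \<in> B \<Longrightarrow> A = B"
  using tiling by (auto simp: dyck_tiling_def partition_on_def disjoint_def)

lemma tile_subset: "A \<in> T \<Longrightarrow> x \<in> A \<Longrightarrow> x \<in> skew_shape n lam mu"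
  using tiling by (auto simp: dyck_tiling_def partition_on_def)

lemma tile_exists: "i \<le> 2 * n \<Longrightarrow> k < layers i \<Longrightarrow> \<exists>A\<in>T. box i k \<in> A"
  using tiling box_in_skew[of i k] by (auto simp: dyck_tiling_def partition_on_def)

lemma tile_bound: "A \<in> T \<Longrightarrow> box i k \<in> A \<Longrightarrow> i \<le> 2 * n \<and> k < layers i"
  using tile_subset box_in_skew by blast

lemma tile_column: "A \<in> T \<Longrightarrow> (int j - int n, y) \<in> A \<Longrightarrow> \<exists>k. y = g j + 2 * int k \<and> box j k \<in> A"
proof -
  assume "A \<in> T" and y: "(int j - int n, y) \<in> A"
  then obtain i k where "(int j - int n, y) = box i k"
    using tile_subset unfolding skew_shape_boxes by blast
  with y show ?thesis using column_box by metis
qed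

lemma tile_function: "A \<in> T \<Longrightarrow> (x, y) \<in> A \<Longrightarrow> (x, y') \<in> A \<Longrightarrow> y = y'"
  using tiling by (auto simp: dyck_tiling_def dyck_tile_def)

lemma tile_adjacent: "A \<in> T \<Longrightarrow> (x, y) \<in> A \<Longrightarrow> (x + 1, y') \<in> A \<Longrightarrow> \<bar>y' - y\<bar> = 1"
  using tiling by (auto simp: dyck_tiling_def dyck_tile_def)

lemma tile_interval: "A \<in> T \<Longrightarrow> (x, y) \<in> A \<Longrightarrow> (x', y') \<in> A \<Longrightarrow> x \<le> z \<Longrightarrow> z \<le> x' \<Longrightarrow> \<exists>y. (z, y) \<in> A"
  using tiling by (fastforce simp: dyck_tiling_def dyck_tile_def)

lemma tile_adjacent_boxes:
  assumes "A \<in> T" "box i k \<in> A" "box i' k' \<in> A" "i' = Suc i \<or> i = Suc i'"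
  shows "\<bar>(g i + 2 * int k) - (g i' + 2 * int k')\<bar> = 1" "\<bar>g i - g i'\<bar> = 1"
proof -
  have "i' < 2 * n \<or> i' = Suc i \<and> i < 2 * n" using assms tile_bound by fastforce
  then show "\<bar>g i - g i'\<bar> = 1" using g_adjacent[of i] g_adjacent[of i'] assms tile_bound by fastforce
  have "i' = Suc i \<Longrightarrow> (int i - int n + 1, g i' + 2 * int k') \<in> A"
    "i = Suc i' \<Longrightarrow> (int i' - int n + 1, g i + 2 * int k) \<in> A"
    using assms by (auto simp: box_def algebra_simps)
  then show "\<bar>(g i + 2 * int k) - (g i' + 2 * int k')\<bar> = 1"
    using assms tile_adjacent[of A] by (fastforce simp: box_def abs_minus_commute)
qed

text \<open>If a tile left its layer, then the tile containing the box just below it would, by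
  cover-inclusiveness, extend to a column where it meets the first tile or leaves a lower layer.\<close>

lemma tile_layer_adjacent:
  assumes IH: "\<And>l A i j l'. l < k \<Longrightarrow> A \<in> T \<Longrightarrow> box i l \<in> A \<Longrightarrow> box j l' \<in> A \<Longrightarrow> l' = l"
    and A: "A \<in> T" "box i k \<in> A" "box i' k' \<in> A" and adj: "i' = Suc i \<or> i = Suc i'"
  shows "k' = k"
proof (rule ccontr)
  assume "k' \<noteq> k"
  moreover have "\<not> k' < k" using IH[of k' A i' i k] A by auto
  ultimately have "k < k'" by simp
  moreover note a = tile_adjacent_boxes[OF A adj]
  \<comment> \<open>Tile and lower path both have slopes \<plusminus>1, so the tile can rise by one
    layer only, and only where the path descends from i to i'.\<close>
  ultimately have k': "k' = Suc k" and g: "g i' = g i - 1" by linarith+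
  obtain C where C: "C \<in> T" "box i' k \<in> C"
    using tile_exists[of i' k] tile_bound[OF A(1,3)] \<open>k < k'\<close> by auto
  have "covers A C" using covers_boxes A(3) C(2) \<open>k < k'\<close> by blast
  then have "columns A \<subseteq> columns C" using incl A(1) C(1) by (simp add: cover_inclusive_def)
  moreover have "int i - int n \<in> columns A" using A(2) by (force simp: columns_def box_def)
  ultimately obtain y where "(int i - int n, y) \<in> C" by (auto simp: columns_def)
  then obtain l where l: "box i l \<in> C" using tile_column[OF C(1)] by blast
  have "\<bar>(g i + 2 * int l) - (g i' + 2 * int k)\<bar> = 1"
    by (rule tile_adjacent_boxes[OF C(1) l C(2) adj])
  then have "l = k \<or> Suc l = k" using g by linarith
  then show False
  proof
    assume "l = k"
    then have "A = C" using tile_unique A C l by blast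
    then have "g i' + 2 * int k' = g i' + 2 * int k"
      using tile_function[of A] A C unfolding box_def by blast
    then show False using k' by simp
  next
    assume "Suc l = k"
    then show False using IH[of l C i i' k] C l by simp
  qed
qed

text \<open>Induction on the layer, as the adjacent case presupposes all lower layers. A tile has no
  gaps, so the adjacent case propagates from column i to column j.\<close>

lemma tile_layer: "A \<in> T \<Longrightarrow> box i k \<in> A \<Longrightarrow> box j k' \<in> A \<Longrightarrow> k' = k"
proof (induction k arbitrary: A i j k' rule: less_induct)
  case (less k)
  have step: "box (Suc l) k \<in> A \<longleftrightarrow> box l k \<in> A" if l: "min i j \<le> l" "l < max i j" for l
  proof -
    have ex: "\<exists>k. box m k \<in> A" if "min i j \<le> m" "m \<le> max i j" for m
    proof -
      have "\<exists>y. (int m - int n, y) \<in> A"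
        using tile_interval[OF less.prems(1) less.prems(2)[unfolded box_def] less.prems(3)[unfolded box_def], of "int m - int n"]
          tile_interval[OF less.prems(1) less.prems(3)[unfolded box_def] less.prems(2)[unfolded box_def], of "int m - int n"]
          that by (auto simp: min_def max_def split: if_splits)
      then show ?thesis using tile_column less.prems(1) by blast
    qed
    obtain k1 k2 where k: "box l k1 \<in> A" "box (Suc l) k2 \<in> A"
      using ex[of l] ex[of "Suc l"] l by auto
    show ?thesis
    proof
      assume "box (Suc l) k \<in> A"
      then have "k1 = k"
        using tile_layer_adjacent[of k A "Suc l" l k1] less.IH less.prems(1) k by blast
      then show "box l k \<in> A" using k by simp
    next
      assume "box l k \<in> A"
      then have "k2 = k"
        using tile_layer_adjacent[of k A l "Suc l" k2] less.IH less.prems(1) k by blast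
      then show "box (Suc l) k \<in> A" using k by simp
    qed
  qed
  have all: "box (min i j + d) k \<in> A \<longleftrightarrow> box (min i j) k \<in> A" if "min i j + d \<le> max i j" for d
    using that
  proof (induction d)
    case (Suc d)
    then show ?case using step[of "min i j + d"] by simp
  qed simp
  have "box i k \<in> A \<longleftrightarrow> box j k \<in> A"
    using all[of "i - min i j"] all[of "j - min i j"] by simp
  then have "g j + 2 * int k = g j + 2 * int k'"
    using less.prems tile_function[of A] unfolding box_def by blast
  then show "k' = k" by simp
qed

lemma tile_is_segment:
  assumes "A \<in> T"
  obtains a b k where "level_segment a b" "k < layers a" "A = segment a b k"
proof -
  obtain \<alpha> \<beta> f where A: "\<alpha> \<le> \<beta>" "A = {(x, f x) |x. \<alpha> \<le> x \<and> x \<le> \<beta>}" and f: "f \<alpha> = f \<beta>"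
      "\<forall>x. \<alpha> \<le> x \<and> x \<le> \<beta> \<longrightarrow> f \<alpha> \<le> f x"
  proof -
    have "dyck_tile A" using tiling assms by (simp add: dyck_tiling_def)
    then show thesis unfolding dyck_tile_def by (elim exE conjE) (rule that)
  qed
  have "(\<alpha>, f \<alpha>) \<in> A" "(\<beta>, f \<beta>) \<in> A" using A by auto
  then obtain a k b k' where ak: "(\<alpha>, f \<alpha>) = box a k" and bk: "(\<beta>, f \<beta>) = box b k'"
    using tile_subset[OF assms] unfolding skew_shape_boxes by blast
  have [simp]: "k' = k" using tile_layer[OF assms, of a k b k'] \<open>(\<alpha>, f \<alpha>) \<in> A\<close> \<open>(\<beta>, f \<beta>) \<in> A\<close> ak bk by simp
  have ab: "\<alpha> = int a - int n" "\<beta> = int b - int n" using ak bk by (auto simp: box_def)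
  have fj: "f (int j - int n) = g j + 2 * int k" if "a \<le> j" "j \<le> b" for j
  proof -
    have "(int j - int n, f (int j - int n)) \<in> A" using that A ab by auto
    then obtain l where l: "f (int j - int n) = g j + 2 * int l" "box j l \<in> A"
      using tile_column[OF assms] by blast
    then show ?thesis using tile_layer[OF assms, of a k j l] \<open>(\<alpha>, f \<alpha>) \<in> A\<close> ak by simp
  qed
  have le: "a \<le> b" using A(1) ab by simp
  have bd: "a \<le> 2 * n \<and> k < layers a" "b \<le> 2 * n"
    using tile_bound[OF assms] \<open>(\<alpha>, f \<alpha>) \<in> A\<close> \<open>(\<beta>, f \<beta>) \<in> A\<close> ak bk by auto
  have "A = segment a b k"
  proof (intro set_eqI iffI)
    fix x assume "x \<in> A"
    moreover from this obtain j l where x: "x = box j l" using tile_subset[OF assms] unfolding skew_shape_boxes by blast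
    ultimately have "l = k" "a \<le> j" "j \<le> b"
      using tile_layer[OF assms, of a k j l] \<open>(\<alpha>, f \<alpha>) \<in> A\<close> ak A ab by (auto simp: box_def)
    then show "x \<in> segment a b k" by (simp add: x)
  next
    fix x assume "x \<in> segment a b k"
    then obtain j where "x = box j k" "a \<le> j" "j \<le> b" by (auto simp: segment_def)
    then show "x \<in> A" using fj[of j] A ab by (auto simp: box_def)
  qed
  moreover have "g a = g b" using fj[of a] fj[of b] f(1) le ab by simp
  moreover have "g a \<le> g j" if "a \<le> j" "j \<le> b" for j
    using fj[of a] fj[of j] f(2)[rule_format, of "int j - int n"] that le ab by simp
  ultimately show thesis using that[of a b k] bd le by (auto simp: level_segment_def)
qed

text \<open>Applied to \<open>r - 1\<close> because steps are numbered from 1 and vertices from 0.\<close>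

definition links :: "nat \<Rightarrow> nat" where
  "links r = card {k. joined T (r - 1) k}"

lemma joined_bound: "joined T j k \<Longrightarrow> j < 2 * n \<and> k < layers j \<and> k < layers (Suc j)"
  using tile_bound by (fastforce simp: joined_def)

lemma joined_down: "joined T j (Suc k) \<Longrightarrow> joined T j k"
proof -
  assume "joined T j (Suc k)"
  then obtain A where A: "A \<in> T" "box j (Suc k) \<in> A" "box (Suc j) (Suc k) \<in> A" by (auto simp: joined_def)
  have b: "j \<le> 2 * n" "Suc k < layers j" using tile_bound[OF A(1,2)] by auto
  then obtain B where B: "B \<in> T" "box j k \<in> B" using tile_exists[of j k] by auto
  have "covers A B" using covers_boxes A(2) B(2) by blast
  then have "columns A \<subseteq> columns B" using incl A(1) B(1) by (simp add: cover_inclusive_def)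
  moreover have "int (Suc j) - int n \<in> columns A" using A(3) by (force simp: columns_def box_def)
  ultimately obtain y where "(int (Suc j) - int n, y) \<in> B" by (auto simp: columns_def)
  then obtain l where "box (Suc j) l \<in> B" using tile_column[OF B(1)] by blast
  moreover from this have "l = k" using tile_layer[OF B] by simp
  ultimately show "joined T j k" using B by (auto simp: joined_def)
qed

text \<open>By cover-inclusiveness the layers joined across a step are closed downwards, so their
  number determines them.\<close>

lemma joined_iff: "joined T j k \<longleftrightarrow> k < links (Suc j)"
proof -
  define S where "S = {k. joined T j k}"
  have "S \<subseteq> {..<layers j}" using joined_bound by (auto simp: S_def)
  then have fin: "finite S" by (rule finite_subset) simp
  have down: "l \<in> S" if "l + d \<in> S" for l d
    using that by (induction d) (auto simp: S_def joined_down)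
  have "S = {..<card S}"
  proof (rule ccontr)
    have sub: "{..k} \<subseteq> S" if "k \<in> S" for k
    proof
      fix l assume "l \<in> {..k}"
      then show "l \<in> S" using down[of l "k - l"] that by simp
    qed
    have "k < card S" if "k \<in> S" for k using card_mono[OF fin sub[OF that]] by simp
    then have "S \<subseteq> {..<card S}" by auto
    moreover assume "S \<noteq> {..<card S}"
    ultimately have "card S < card {..<card S}" by (intro psubset_card_mono) auto
    then show False by simp
  qed
  then show ?thesis by (auto simp: links_def S_def)
qed

text \<open>A tile crossing the up step of a chord cannot end before the down step: its last vertex
  would be higher than s - 1, although the ends are lowest. Symmetrically, a tile crossing the down
  step reaches back to s - 1. Either way it crosses everything in between.\<close>

lemma valid_links: "valid links"
  unfolding valid_def
proof (intro conjI allI impI)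
  fix i
  show "links (Suc i) \<le> layers i" "links (Suc i) \<le> layers (Suc i)"
    using joined_bound[of i] joined_iff[of i] by (meson not_less order_less_irrefl)+
next
  show "\<forall>(s, t)\<in>tree_chords w 0. links s = links t \<and> (\<forall>r\<in>{s..t}. links s \<le> links r)"
  proof clarify
    fix s t assume st: "(s, t) \<in> tree_chords w 0"
    note c = chord_props[OF st]
    have suc: "Suc (s - 1) = s" "Suc (t - 1) = t" using c by auto
    have join: "k < links r" if "A \<in> T" "A = segment a b k" "a \<le> s - 1" "t \<le> b" "s \<le> r" "r \<le> t" for A a b k r
      using joined_iff[of "r - 1" k] that c(1) by (auto simp: joined_def intro!: bexI[of _ A])
    have fwd: "k < links r" if k: "k < links s" and r: "s \<le> r" "r \<le> t" for k r
    proof -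
      obtain A where A: "A \<in> T" "box (s - 1) k \<in> A" "box s k \<in> A"
        using joined_iff[of "s - 1" k] k suc by (auto simp: joined_def)
      obtain a b l where ab: "level_segment a b" "A = segment a b l" using tile_is_segment[OF A(1)] by metis
      have "l = k" "a \<le> s - 1" "s \<le> b" using A ab by auto
      moreover have "t \<le> b"
      proof (rule ccontr)
        assume "\<not> t \<le> b"
        then have "g (s - 1) < g b" using c(5) \<open>s \<le> b\<close> by simp
        moreover have "g b \<le> g (s - 1)" using level_segmentD[OF ab(1) \<open>a \<le> s - 1\<close>] \<open>s \<le> b\<close> by simp
        ultimately show False by simp
      qed
      ultimately show ?thesis using join[OF A(1)] ab(2) r by blast
    qed
    have bwd: "k < links s" if k: "k < links t" for k
    proof -
      obtain A where A: "A \<in> T" "box (t - 1) k \<in> A" "box t k \<in> A"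
        using joined_iff[of "t - 1" k] k suc by (auto simp: joined_def)
      obtain a b l where ab: "level_segment a b" "A = segment a b l" using tile_is_segment[OF A(1)] by metis
      have "l = k" "a \<le> t - 1" "t \<le> b" using A ab by auto
      moreover have "a \<le> s - 1"
      proof (rule ccontr)
        assume "\<not> a \<le> s - 1"
        then have "g (s - 1) < g a" using c(2,5) \<open>a \<le> t - 1\<close> by simp
        moreover have "g a \<le> g t" using level_segmentD[OF ab(1), of t] \<open>a \<le> t - 1\<close> \<open>t \<le> b\<close> by simp
        ultimately show False using c(4) by simp
      qed
      ultimately show ?thesis using join[OF A(1)] ab(2) c(2) by (metis less_imp_le_nat order_refl)
    qed
    have le: "links s \<le> links r" if "r \<in> {s..t}" for r
      using fwd[of _ r] that by (meson atLeastAtMost_iff not_less order_less_irrefl)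
    moreover have "links t \<le> links s" using bwd by (meson not_less order_less_irrefl)
    ultimately show "links s = links t \<and> (\<forall>r\<in>{s..t}. links s \<le> links r)"
      using c(2) by (auto intro: antisym)
  qed
qed

text \<open>A link beyond an end of the segment would come from a tile that contains the end box,
  and by disjointness this tile is the segment itself.\<close>

lemma tile_eq_segment:
  assumes A: "segment a b k \<in> T" and ab: "level_segment a b"
  shows "tile links a k = segment a b k"
proof -
  have "j \<le> 2 * n \<and> linked links k a j \<longleftrightarrow> a \<le> j \<and> j \<le> b" for j
  proof
    assume j: "a \<le> j \<and> j \<le> b"
    have "k < links r" if "a < r" "r \<le> j" for r
      using joined_iff[of "r - 1" k] A j that by (auto simp: joined_def intro!: bexI[of _ "segment a b k"])
    then show "j \<le> 2 * n \<and> linked links k a j" using ab j by (auto simp: linked_def level_segment_def)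
  next
    assume j: "j \<le> 2 * n \<and> linked links k a j"
    show "a \<le> j \<and> j \<le> b"
    proof (rule ccontr)
      assume "\<not> (a \<le> j \<and> j \<le> b)"
      then consider "j < a" | "b < j" by linarith
      then show False
      proof cases
        case 1
        then have "k < links a" "Suc (a - 1) = a" using j by (auto simp: linked_def)
        then obtain B where "B \<in> T" "box (a - 1) k \<in> B" "box a k \<in> B"
          using joined_iff[of "a - 1" k] by (auto simp: joined_def)
        moreover from this have "B = segment a b k"
          using tile_unique[OF _ A] ab by (auto simp: level_segment_def)
        ultimately show False using \<open>Suc (a - 1) = a\<close> by auto
      next
        case 2
        then have "k < links (Suc b)" using j ab by (auto simp: linked_def level_segment_def)
        then obtain B where "B \<in> T" "box b k \<in> B" "box (Suc b) k \<in> B"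
          using joined_iff[of b k] by (auto simp: joined_def)
        moreover from this have "B = segment a b k"
          using tile_unique[OF _ A] ab by (auto simp: level_segment_def)
        ultimately show False by simp
      qed
    qed
  qed
  then have "{j. j \<le> 2 * n \<and> linked links k a j} = {a..b}" by (simp only: atLeastAtMost_def atLeast_def atMost_def Int_def mem_Collect_eq)
  then show ?thesis unfolding tile_def segment_def by (rule arg_cong)
qed

lemma tiles_links: "tiles links = T"
proof
  show "T \<subseteq> tiles links"
  proof
    fix A assume A: "A \<in> T"
    obtain a b k where ab: "level_segment a b" "k < layers a" "A = segment a b k"
      using tile_is_segment[OF A] .
    then have "A = tile links a k" using tile_eq_segment A by simp
    moreover have "a \<le> 2 * n" using ab by (simp add: level_segment_def)
    ultimately show "A \<in> tiles links" using ab by (auto simp: tiles_def)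
  qed
  show "tiles links \<subseteq> T"
  proof
    fix A assume "A \<in> tiles links"
    then obtain i k where A: "A = tile links i k" "i \<le> 2 * n" "k < layers i" by (auto simp: tiles_def)
    then obtain B where B: "B \<in> T" "box i k \<in> B" using tile_exists by blast
    obtain a b l where ab: "level_segment a b" "B = segment a b l"
      using tile_is_segment[OF B(1)] by metis
    have "l = k" using B ab by simp
    then have eq: "tile links a k = B" using tile_eq_segment[of a b k] B ab by simp
    then have "linked links k a i" using B(2) by auto
    then have "tile links a k = A" using A tile_eq by simp
    then show "A \<in> T" using eq B by simp
  qed
qed

end

lemma valid_cong:
  assumes "\<And>r. 1 \<le> r \<Longrightarrow> r \<le> 2 * n \<Longrightarrow> M r = M' r" "valid M"
  shows "valid M'"
  unfolding valid_def
proof (intro conjI allI impI)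
  fix i assume i: "i < 2 * n"
  then have "M (Suc i) \<le> layers i \<and> M (Suc i) \<le> layers (Suc i)" using assms(2) unfolding valid_def by blast
  then show "M' (Suc i) \<le> layers i" "M' (Suc i) \<le> layers (Suc i)" using assms(1)[of "Suc i"] i by simp_all
next
  show "\<forall>(s, t)\<in>tree_chords w 0. M' s = M' t \<and> (\<forall>r\<in>{s..t}. M' s \<le> M' r)"
  proof clarify
    fix s t assume st: "(s, t) \<in> tree_chords w 0"
    note c = chord_props[OF st]
    have "M r = M' r" if "r \<in> {s..t}" for r using assms(1)[of r] that c by simp
    moreover have "M s = M t \<and> (\<forall>r\<in>{s..t}. M s \<le> M r)" using assms(2) st by (auto simp: valid_def)
    ultimately show "M' s = M' t \<and> (\<forall>r\<in>{s..t}. M' s \<le> M' r)" using c(2) by auto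
  qed
qed

lemma tiles_cong:
  assumes "\<And>r. 1 \<le> r \<Longrightarrow> r \<le> 2 * n \<Longrightarrow> M r = M' r"
  shows "tiles M = tiles M'"
proof -
  have "linked M k i j \<longleftrightarrow> linked M' k i j" if "i \<le> 2 * n" "j \<le> 2 * n" for k i j
  proof -
    have "M r = M' r" if "min i j < r \<and> r \<le> max i j" for r
    proof -
      have "1 \<le> r" "r \<le> 2 * n" using that \<open>i \<le> 2 * n\<close> \<open>j \<le> 2 * n\<close> by linarith+
      then show ?thesis by (rule assms)
    qed
    then show ?thesis unfolding linked_def by metis
  qed
  then have "tile M i k = tile M' i k" if "i \<le> 2 * n" for i k using that by (auto simp: tile_def)
  then show ?thesis unfolding tiles_def by force
qed

text \<open>Lists replace functions because the values of a function outside {1..2n} would spoil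
  injectivity.\<close>

lemma bij_tilings:
  "bij_betw (\<lambda>ms. tiles (list_fun ms)) {ms. length ms = 2 * n \<and> valid (list_fun ms)}
     {T. dyck_tiling n lam mu T \<and> cover_inclusive T}"
proof (rule bij_betw_imageI)
  show "inj_on (\<lambda>ms. tiles (list_fun ms)) {ms. length ms = 2 * n \<and> valid (list_fun ms)}"
  proof (rule inj_onI)
    fix ms ms' assume ms: "ms \<in> {ms. length ms = 2 * n \<and> valid (list_fun ms)}"
      and ms': "ms' \<in> {ms. length ms = 2 * n \<and> valid (list_fun ms)}"
      and eq: "tiles (list_fun ms) = tiles (list_fun ms')"
    show "ms = ms'"
    proof (rule nth_equalityI)
      show "length ms = length ms'" using ms ms' by simp
      fix i assume "i < length ms"
      then have i: "i < 2 * n" using ms by simp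
      have "k < ms ! i \<longleftrightarrow> k < ms' ! i" for k
        using joined_tiles[of "list_fun ms" i k] joined_tiles[of "list_fun ms'" i k] i ms ms' eq
        by (simp add: list_fun_def)
      then show "ms ! i = ms' ! i" by (metis linorder_neqE_nat less_irrefl)
    qed
  qed
  show "(\<lambda>ms. tiles (list_fun ms)) ` {ms. length ms = 2 * n \<and> valid (list_fun ms)} =
     {T. dyck_tiling n lam mu T \<and> cover_inclusive T}"
  proof (intro set_eqI iffI)
    fix T assume "T \<in> (\<lambda>ms. tiles (list_fun ms)) ` {ms. length ms = 2 * n \<and> valid (list_fun ms)}"
    then show "T \<in> {T. dyck_tiling n lam mu T \<and> cover_inclusive T}" using tiles_tiling by auto
  next
    fix T assume "T \<in> {T. dyck_tiling n lam mu T \<and> cover_inclusive T}"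
    then have T: "dyck_tiling n lam mu T" "cover_inclusive T" by auto
    define ms where "ms = map (links T) [1..<Suc (2 * n)]"
    have eq: "links T r = list_fun ms r" if "1 \<le> r" "r \<le> 2 * n" for r
      using that by (simp add: ms_def list_fun_def del: upt_Suc)
    have "valid (list_fun ms)" using valid_cong[OF eq valid_links[OF T]] .
    moreover have "tiles (list_fun ms) = T" using tiles_cong[OF eq] tiles_links[OF T] by simp
    moreover have "length ms = 2 * n" by (simp add: ms_def)
    ultimately show "T \<in> (\<lambda>ms. tiles (list_fun ms)) ` {ms. length ms = 2 * n \<and> valid (list_fun ms)}" by blast
  qed
qed

end

section \<open>The generating functions\<close>

lemma gain_eq_dis: "length lam = 2 * m \<Longrightarrow> length mu = 2 * m \<Longrightarrow> gain lam mu = dis m lam mu"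
proof -
  assume len: "length lam = 2 * m" "length mu = 2 * m"
  have "gain lam mu = card {i. i < 2 * m \<and> lam ! i = Down \<and> mu ! i = Up}"
    using len by (auto simp: gain_def length_filter_conv_card intro!: arg_cong[of _ _ card])
  also have "\<dots> = card (Suc ` {i. i < 2 * m \<and> lam ! i = Down \<and> mu ! i = Up})"
    by (simp add: card_image)
  also have "Suc ` {i. i < 2 * m \<and> lam ! i = Down \<and> mu ! i = Up} =
      {k \<in> {1..2 * m}. step_at lam k = Down \<and> step_at mu k = Up}"
  proof (intro set_eqI iffI)
    fix k assume "k \<in> {k \<in> {1..2 * m}. step_at lam k = Down \<and> step_at mu k = Up}"
    then show "k \<in> Suc ` {i. i < 2 * m \<and> lam ! i = Down \<and> mu ! i = Up}"
      by (cases k) (auto simp: step_at_def)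
  qed (auto simp: step_at_def)
  finally show ?thesis by (simp add: dis_def)
qed

text \<open>With no boxes at either end, nonnegative counts say that the upper path ends at height 0
  and lies weakly above; it is then a Dyck path because the lower path is nonnegative.\<close>

lemma configs_iff_valid:
  "(mu, ms, 0) \<in> configs w 0 0 \<longleftrightarrow> tree_and_upper_path w mu \<and> length ms = 2 * size w \<and>
     tree_and_upper_path.valid w mu (list_fun ms)"
proof (cases "length mu = 2 * size w \<and> length ms = 2 * size w")
  case False
  then show ?thesis using configs_length[of mu ms 0 w 0 0]
    by (auto simp: tree_and_upper_path_def dyck_path_def)
next
  case True
  then have len: "length mu = length (word w)" "length ms = length (word w)" by auto
  let ?C = "\<forall>(i, j)\<in>tree_chords w 0. ms ! (i - 1) = ms ! (j - 1) \<and> (\<forall>r\<in>{i..j}. ms ! (i - 1) \<le> ms ! (r - 1))"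
  let ?H = "\<lambda>i. height mu i - height (word w) i"
  have nested: "nested w 0 ms \<longleftrightarrow> ?C"
    using nested_iff[of ms w 0 "[]" "[]"] True by simp
  have walk: "walk (word w) mu ms 0 0 \<longleftrightarrow>
     (\<forall>i\<le>2 * size w. 0 \<le> ?H i) \<and> ?H (2 * size w) = 0 \<and>
     (\<forall>i<2 * size w. 2 * int (ms ! i) \<le> ?H i \<and> 2 * int (ms ! i) \<le> ?H (Suc i))"
    using walk_iff[OF len, of 0 0] by simp
  have above: "tree_and_upper_path w mu \<longleftrightarrow> (\<forall>i\<le>2 * size w. 0 \<le> ?H i) \<and> ?H (2 * size w) = 0"
    using True order_trans[OF height_word_nonneg]
    by (fastforce simp: tree_and_upper_path_def dyck_path_def weakly_above_def)
  have "tree_and_upper_path.valid w mu (list_fun ms) \<longleftrightarrow>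
      (\<forall>i<2 * size w. 2 * int (ms ! i) \<le> ?H i \<and> 2 * int (ms ! i) \<le> ?H (Suc i)) \<and> ?C"
    if "tree_and_upper_path w mu"
  proof -
    interpret tree_and_upper_path w mu by (fact that)
    have "2 * int m \<le> ?H i \<longleftrightarrow> m \<le> layers i" if "i \<le> 2 * size w" for m i
      using layers[OF that] by (simp add: g_def)
    then show ?thesis by (auto simp: valid_def list_fun_def)
  qed
  then show ?thesis unfolding configs_iff nested walk above using True above by blast
qed

lemma bij_configs_tilings:
  "bij_betw (\<lambda>(mu, ms, q). (mu, tree_and_upper_path.tiles w mu (list_fun ms)))
     {c \<in> configs w 0 0. snd (snd c) = 0} (cover_inclusive_tilings (size w) (word w))"
proof -
  define S where "S mu = {ms. length ms = 2 * size w \<and> tree_and_upper_path.valid w mu (list_fun ms)}" for mu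
  define F where "F mu ms = tree_and_upper_path.tiles w mu (list_fun ms)" for mu ms
  have bij: "bij_betw (F mu) (S mu) {T. dyck_tiling (size w) (word w) mu T \<and> cover_inclusive T}"
    if "tree_and_upper_path w mu" for mu
    unfolding F_def S_def by (rule tree_and_upper_path.bij_tilings[OF that])
  have dom: "{c \<in> configs w 0 0. snd (snd c) = 0} =
     {(mu, ms, q). tree_and_upper_path w mu \<and> ms \<in> S mu \<and> q = 0}"
    unfolding S_def by (auto simp: configs_iff_valid)
  have cod: "cover_inclusive_tilings (size w) (word w) =
     {(mu, T). tree_and_upper_path w mu \<and> T \<in> {T. dyck_tiling (size w) (word w) mu T \<and> cover_inclusive T}}"
    by (auto simp: cover_inclusive_tilings_def tree_and_upper_path_def)
  show ?thesis unfolding dom cod F_def[symmetric]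
  proof (rule bij_betw_imageI)
    show "inj_on (\<lambda>(mu, ms, q). (mu, F mu ms)) {(mu, ms, q). tree_and_upper_path w mu \<and> ms \<in> S mu \<and> q = 0}"
      using bij by (auto simp: bij_betw_def inj_on_def)
    show "(\<lambda>(mu, ms, q). (mu, F mu ms)) ` {(mu, ms, q). tree_and_upper_path w mu \<and> ms \<in> S mu \<and> q = 0} =
      {(mu, T). tree_and_upper_path w mu \<and> T \<in> {T. dyck_tiling (size w) (word w) mu T \<and> cover_inclusive T}}"
    proof (intro set_eqI iffI; clarify)
      fix mu ms assume "tree_and_upper_path w mu" "ms \<in> S mu"
      then show "dyck_tiling (size w) (word w) mu (F mu ms) \<and> cover_inclusive (F mu ms)"
        using bij[of mu] by (auto simp: bij_betw_def)
    next
      fix mu T assume t: "tree_and_upper_path w mu" "dyck_tiling (size w) (word w) mu T" "cover_inclusive T"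
      then obtain ms where "ms \<in> S mu" "T = F mu ms" using bij[of mu] by (auto simp: bij_betw_def)
      then show "(mu, T) \<in> (\<lambda>(mu, ms, q). (mu, F mu ms)) `
          {(mu, ms, q). tree_and_upper_path w mu \<and> ms \<in> S mu \<and> q = 0}"
        using t by force
    qed
  qed
qed

lemma tilings_gf:
  "(\<Sum>(mu, T)\<in>cover_inclusive_tilings (size w) (word w). fps_X ^ dis (size w) (word w) mu) = transfer w 1 $ 0"
proof -
  let ?C = "{c \<in> configs w 0 0. snd (snd c) = 0}"
  have "(\<Sum>(mu, T)\<in>cover_inclusive_tilings (size w) (word w). fps_X ^ dis (size w) (word w) mu :: int fps) =
     (\<Sum>(mu, ms, q)\<in>?C. fps_X ^ dis (size w) (word w) mu)"
    by (subst sum.reindex_bij_betw[OF bij_configs_tilings, symmetric]) (simp add: case_prod_beta)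
  also have "\<dots> = (\<Sum>(mu, ms, q)\<in>?C. fps_X ^ gain (word w) mu * 1 $ q)"
    by (rule sum.cong) (auto simp: gain_eq_dis dest!: configs_length)
  \<comment> \<open>The series 1 acts as the indicator of q = 0.\<close>
  also have "\<dots> = (\<Sum>(mu, ms, q)\<in>configs w 0 0. fps_X ^ gain (word w) mu * 1 $ q)"
    by (rule sum.mono_neutral_left) (auto simp: finite_configs split: if_splits)
  also have "\<dots> = transfer w 1 $ 0" using sum_configs[of 0 0 w 1] by simp
  finally show ?thesis .
qed

text \<open>Equality over the integers means that each exponent occurs equally often on both sides.
  In this form it passes to every commutative semiring, where 1 - z need not make sense.\<close>

lemma sum_powers_cong:
  fixes z :: "'c::comm_semiring_1"
  assumes "finite A" "finite B"
    and eq: "(\<Sum>x\<in>A. fps_X ^ a x :: int fps) = (\<Sum>y\<in>B. fps_X ^ b y)"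
  shows "(\<Sum>x\<in>A. z ^ a x) = (\<Sum>y\<in>B. z ^ b y)"
proof -
  have coeff: "(\<Sum>x\<in>A. fps_X ^ a x :: int fps) $ d = int (card {x \<in> A. a x = d})" if "finite A"
    for A :: "'e set" and a d
  proof -
    have "(\<Sum>x\<in>A. fps_X ^ a x :: int fps) $ d = (\<Sum>x\<in>A. if a x = d then 1 else 0)"
      by (auto simp: fps_sum_nth intro!: sum.cong)
    also have "\<dots> = int (card {x \<in> A. a x = d})" using that by (simp add: sum.If_cases Int_def)
    finally show ?thesis .
  qed
  have card: "card {x \<in> A. a x = d} = card {y \<in> B. b y = d}" for d
    using arg_cong[OF eq, of "\<lambda>f. f $ d"] coeff[OF assms(1), of a d] coeff[OF assms(2), of b d] by simp
  define D where "D = a ` A \<union> b ` B"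
  have D: "finite D" using assms by (simp add: D_def)
  have group: "(\<Sum>x\<in>A. z ^ a x) = (\<Sum>d\<in>D. of_nat (card {x \<in> A. a x = d}) * z ^ d)" if "finite A" "a ` A \<subseteq> D"
    for A :: "'e set" and a
  proof -
    have "(\<Sum>x\<in>A. z ^ a x) = (\<Sum>d\<in>D. \<Sum>x\<in>{x \<in> A. a x = d}. z ^ a x)"
      by (rule sum.group[OF that(1) D that(2), symmetric])
    also have "\<dots> = (\<Sum>d\<in>D. of_nat (card {x \<in> A. a x = d}) * z ^ d)" by (intro sum.cong refl) simp
    finally show ?thesis .
  qed
  show ?thesis using group[OF assms(1), of a] group[OF assms(2), of b] by (simp add: D_def card)
qed

theorem theorem2:
  fixes n :: nat and lam :: "step list" and z :: "'a::comm_semiring_1"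
  assumes "dyck_path n lam"
  shows "(\<Sum>(mu, T)\<in>cover_inclusive_tilings n lam. z ^ dis n lam mu)
       = (\<Sum>\<sigma>\<in>label_perms n lam. z ^ des n \<sigma>)"
proof -
  obtain w where w: "lam = word w" "n = size w" using dyck_path_word[OF assms] .
  have "(\<Sum>x\<in>cover_inclusive_tilings n lam. fps_X ^ dis n lam (fst x) :: int fps) =
      (\<Sum>\<sigma>\<in>label_perms n lam. fps_X ^ des n \<sigma>)"
    using tilings_gf[of w] transfer_one[of w] label_perms_gf[of w] by (simp add: w case_prod_beta)
  from sum_powers_cong[OF finite_cover_inclusive_tilings finite_label_perms this, of z]
  show ?thesis by (simp add: case_prod_beta)
qed

end
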